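(* Let $d\ge 3$. Consider polluted bootstrap percolation on $\mathbb{Z}^d$ with threshold $r=2$, density $p>0$ of initially occupied sites, and density $q>0$ of closed sites. Then $$\mathbb{P}\bigl(\text{the origin is eventually occupied}\bigr)\to 1\qquad\text{as }(p,q)\to(0,0).$$ Moreover, the probability that the origin lies in an infinite connected set of eventually occupied sites also tends to $1$ as $(p,q)\to(0,0)$. The same two statements hold for modified polluted bootstrap percolation on $\mathbb{Z}^d$ with threshold $r=2$.
   Context: Elements of $\mathbb{Z}^d$ are called sites; sites $u,v$ are neighbors if $\|u-v\|_1=1$. A set of sites is connected if it induces a connected subgraph of this nearest-neighbor graph. Let $e_1,\dots,e_d$ be the coordinate vectors. Polluted bootstrap percolation with parameters $p,q$ ($p+q\le 1$) and threshold $r$: initially (time $0$), independently for each site, the site is closed with probability $q$, open and initially occupied with probability $p$, and open but not initially occupied with probability $1-p-q$. The configuration evolves deterministically in discrete time $t=0,1,2,\dots$: an open site $x$ that is unoccupied at time $t$ becomes occupied at time $t+1$ if and only if at least $r$ neighbors of $x$ are occupied at time $t$. Closed sites remain closed forever and never become occupied; open sites remain open; occupied sites remain occupied. A site is eventually occupied if it is occupied at some time $t\ge 0$. Modified polluted bootstrap percolation: the same, except that an open unoccupied site $x$ becomes occupied at time $t+1$ if and only if for at least $r$ of the directions $i=1,\dots,d$, at least one of $x-e_i$, $x+e_i$ is occupied at time $t$. The limit $(p,q)\to(0,0)$ is the joint limit, with no constraint on the relative rates at which $p$ and $q$ tend to $0$. *)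

theory Defs
  imports "HOL-Probability.Probability"
begin

datatype site_state = Closed | Initially_Occupied | Initially_Vacant

type_synonym 'd site = "int ^ 'd"
type_synonym 'd config = "'d site \<Rightarrow> site_state"

definition l1_norm :: "('d::finite) site \<Rightarrow> int" where
  "l1_norm x = (\<Sum>i\<in>UNIV. \<bar>x $ i\<bar>)"

definition neighbors :: "('d::finite) site \<Rightarrow> 'd site \<Rightarrow> bool" where
  "neighbors u v \<longleftrightarrow> l1_norm (u - v) = 1"

definition connected_sites :: "('d::finite) site set \<Rightarrow> bool" where
  "connected_sites S \<longleftrightarrow>
     (\<forall>u\<in>S. \<forall>v\<in>S. (u, v) \<in> {(a, b). a \<in> S \<and> b \<in> S \<and> neighbors a b}\<^sup>*)"

text \<open>A growth rule decides, from the set of currently occupied sites, whether an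
  open unoccupied site becomes occupied in the next step.\<close>

type_synonym 'd rule = "'d site set \<Rightarrow> 'd site \<Rightarrow> bool"

definition standard_rule :: "nat \<Rightarrow> ('d::finite) rule" where
  "standard_rule r A x \<longleftrightarrow> card {y \<in> A. neighbors x y} \<ge> r"

definition modified_rule :: "nat \<Rightarrow> ('d::finite) rule" where
  "modified_rule r A x \<longleftrightarrow> card {i. x - axis i 1 \<in> A \<or> x + axis i 1 \<in> A} \<ge> r"

primrec occupied :: "('d::finite) rule \<Rightarrow> 'd config \<Rightarrow> nat \<Rightarrow> 'd site set" where
  "occupied R \<omega> 0 = {x. \<omega> x = Initially_Occupied}"
| "occupied R \<omega> (Suc t) =
     occupied R \<omega> t \<union> {x. \<omega> x \<noteq> Closed \<and> x \<notin> occupied R \<omega> t \<and> R (occupied R \<omega> t) x}"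

definition eventually_occupied :: "('d::finite) rule \<Rightarrow> 'd config \<Rightarrow> 'd site set" where
  "eventually_occupied R \<omega> = (\<Union>t. occupied R \<omega> t)"

definition in_infinite_occupied_set :: "('d::finite) rule \<Rightarrow> 'd config \<Rightarrow> 'd site \<Rightarrow> bool" where
  "in_infinite_occupied_set R \<omega> x \<longleftrightarrow>
     (\<exists>S. x \<in> S \<and> infinite S \<and> connected_sites S \<and> S \<subseteq> eventually_occupied R \<omega>)"

definition site_pmf :: "real \<Rightarrow> real \<Rightarrow> site_state pmf" where
  "site_pmf p q = embed_pmf (\<lambda>s. case s of
     Closed \<Rightarrow> q | Initially_Occupied \<Rightarrow> p | Initially_Vacant \<Rightarrow> 1 - p - q)"

text \<open>The weights are a probability vector only for the parameters below; outside this
  range \<^const>\<open>embed_pmf\<close> is unspecified.\<close>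

lemma pmf_site_pmf:
  assumes "0 \<le> p" "0 \<le> q" "p + q \<le> 1"
  shows "pmf (site_pmf p q) s =
    (case s of Closed \<Rightarrow> q | Initially_Occupied \<Rightarrow> p | Initially_Vacant \<Rightarrow> 1 - p - q)"
proof -
  have U: "(UNIV :: site_state set) = {Closed, Initially_Occupied, Initially_Vacant}"
    using site_state.exhaust by auto
  show ?thesis
    unfolding site_pmf_def using assms
    by (subst pmf_embed_pmf)
      (auto simp: U nn_integral_count_space_finite ennreal_plus[symmetric]
        simp del: ennreal_plus split: site_state.split)
qed

definition config_measure :: "real \<Rightarrow> real \<Rightarrow> ('d::finite) config measure" where
  "config_measure p q = PiM UNIV (\<lambda>_. measure_pmf (site_pmf p q))"

definition small_params :: "(real \<times> real) filter" where
  "small_params = at (0, 0) within {(p, q). 0 < p \<and> 0 < q \<and> p + q \<le> 1}"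

end

theory Submission
  imports Defs
begin

text \<open>Occupation under the modified rule implies occupation under the standard rule, and both
  processes on a three-dimensional coordinate subspace are dominated by those on the whole lattice,
  so it suffices to treat the modified rule on sites supported on three axes.

  If the density \<open>q\<close> of closed sites is small, a Peierls argument in the style of Lipschitz
  percolation yields, with high probability, a thick sheet of open sites through the origin,
  transverse to \<open>(1, 1, 1)\<close> and strictly monotone in each coordinate. On such a sheet threshold-two
  growth behaves as on an unpolluted plane: an occupied piece of the sheet inside a cube extends
  across each face of the cube as soon as the adjacent slice contains one initially
  occupied site. As slices grow linearly, sufficiently large cubes keep growing for ever, however
  small \<open>p\<close> is, and far away on the sheet some large fully occupied cube exists. Hence almost
  surely the entire sheet becomes occupied. The sheet depends only on the closed sites, so
  conditionally on it the initially occupied sites are still independent.\<close>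

section \<open>The growth rules\<close>

text \<open>Since the rates of \<open>p\<close> and \<open>q\<close> are unrelated, growth and
  obstruction have to be decoupled. Given the sheet, filling it has probability at least 1 - e for
  every e > 0 and every positive seed density. The only loss governed by a parameter is 4 * r, the
  price of a sheet through the origin, and it asks just for q \<le> r ^ 41.

  An advancing slice meets the threshold with two different directions: the direction of advance,
  supplied by the predecessor in the sheet, and a direction inside the slice. Hence one seed per
  slice is enough, and the modified rule is no harder than the standard one.

  The height is 10 times the coordinate sum minus a 1-Lipschitz correction, which gives slopes
  between 9 and 11. Thickness 40 means that avoiding one closed site raises the correction by at
  most 41; this is the exponent of r. The correction is built on all of Z^d against all closed
  sites, and only the surface is cut down to three axes.\<close>

lemma axis_component: "axis i (c::int) $ j = (if j = i then c else 0)"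
  by (simp add: axis_def)

lemma neighbors_axis:
  "neighbors x (x + axis i 1)" "neighbors x (x - axis i 1)"
  by (simp_all add: neighbors_def l1_norm_def axis_component if_distrib[of abs] cong: if_cong)

lemma neighbors_commute: "neighbors x y \<longleftrightarrow> neighbors y x"
  by (simp add: neighbors_def l1_norm_def abs_minus_commute)

lemma finite_neighbors: "finite {y :: ('d::finite) site. neighbors x y}"
proof -
  have "{y. neighbors x y} \<subseteq> vec_lambda ` (\<Pi>\<^sub>E i\<in>UNIV. {x $ i - 1 .. x $ i + 1})"
  proof
    fix y assume "y \<in> {y. neighbors x y}"
    then have n: "(\<Sum>i\<in>UNIV. \<bar>(x - y) $ i\<bar>) = 1" by (simp add: neighbors_def l1_norm_def)
    have "\<bar>(x - y) $ i\<bar> \<le> 1" for i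
      using member_le_sum[of i UNIV "\<lambda>i. \<bar>(x - y) $ i\<bar>"] n by simp
    then have "x $ i - 1 \<le> y $ i" "y $ i \<le> x $ i + 1" for i
      by (simp_all add: abs_le_iff algebra_simps)
    then have "vec_nth y \<in> (\<Pi>\<^sub>E i\<in>UNIV. {x $ i - 1 .. x $ i + 1})"
      by (simp add: PiE_def Pi_def)
    then show "y \<in> vec_lambda ` (\<Pi>\<^sub>E i\<in>UNIV. {x $ i - 1 .. x $ i + 1})"
      by (rule image_eqI[rotated]) (simp add: vec_nth_inverse)
  qed
  then show ?thesis by (rule finite_subset) (auto intro!: finite_PiE)
qed

lemma card_ge_2: "finite S \<Longrightarrow> 2 \<le> card S \<longleftrightarrow> (\<exists>a\<in>S. \<exists>b\<in>S. a \<noteq> b)"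
  by (metis card_le_Suc0_iff_eq not_less_eq_eq numeral_2_eq_2)

lemma standard_rule_2:
  "standard_rule 2 A x \<longleftrightarrow> (\<exists>y z. y \<in> A \<and> z \<in> A \<and> y \<noteq> z \<and> neighbors x y \<and> neighbors x z)"
proof -
  have "finite {y \<in> A. neighbors x y}" using finite_neighbors[of x] by (rule rev_finite_subset) auto
  then show ?thesis unfolding standard_rule_def by (subst card_ge_2) auto
qed

lemma modified_rule_2:
  "modified_rule 2 A x \<longleftrightarrow> (\<exists>i j. i \<noteq> j \<and> (x - axis i 1 \<in> A \<or> x + axis i 1 \<in> A) \<and>
     (x - axis j 1 \<in> A \<or> x + axis j 1 \<in> A))"
  unfolding modified_rule_def by (subst card_ge_2) auto

lemma axis_ne:
  assumes "i \<noteq> j"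
  shows "x + axis i (1::int) \<noteq> x + axis j 1" "x + axis i (1::int) \<noteq> x - axis j 1"
    "x - axis i (1::int) \<noteq> x + axis j 1" "x - axis i (1::int) \<noteq> x - axis j 1"
  using assms by (auto simp: vec_eq_iff axis_component dest: spec[of _ i])

text \<open>The two witnesses lie on different axes through \<open>x\<close>, so they are distinct
  neighbours.\<close>

lemma modified_imp_standard: "modified_rule 2 A x \<Longrightarrow> standard_rule 2 A x"
  proof -
  assume "modified_rule 2 A x"
  then obtain i j y z where ij: "i \<noteq> j" "y = x - axis i 1 \<or> y = x + axis i 1" "z = x - axis j 1 \<or> z = x + axis j 1"
    and yz: "y \<in> A" "z \<in> A"
    unfolding modified_rule_2 by blast
  have "y \<noteq> z" using ij(2,3) axis_ne[OF ij(1)] by (elim disjE) simp_all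
  moreover have "neighbors x y" "neighbors x z" using ij(2,3) neighbors_axis by blast+
  ultimately show ?thesis using yz unfolding standard_rule_2 by blast
qed

lemma standard_rule_mono: "A \<subseteq> B \<Longrightarrow> standard_rule 2 A x \<Longrightarrow> standard_rule 2 B x"
  unfolding standard_rule_2 by blast

lemma eventually_occupied_modified_subset:
  "eventually_occupied (modified_rule 2) \<omega> \<subseteq> eventually_occupied (standard_rule 2) \<omega>"
proof -
  have "occupied (modified_rule 2) \<omega> t \<subseteq> occupied (standard_rule 2) \<omega> t" for t
    by (induction t) (auto dest!: modified_imp_standard intro: standard_rule_mono)
  then show ?thesis unfolding eventually_occupied_def by blast
qed

lemma occupied_mono_time: "s \<le> t \<Longrightarrow> occupied R \<omega> s \<subseteq> occupied R \<omega> t"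
  by (rule lift_Suc_mono_le[of "occupied R \<omega>"]) auto

lemma eventually_occupied_closed:
  assumes "modified_rule 2 (eventually_occupied (modified_rule 2) \<omega>) x" "\<omega> x \<noteq> Closed"
  shows "x \<in> eventually_occupied (modified_rule 2) \<omega>"
proof -
  \<comment> \<open>The two witnesses may become occupied at different times; by monotonicity both
    are occupied at the later one.\<close>
  have common: "\<exists>t. y \<in> occupied (modified_rule 2) \<omega> t \<and> z \<in> occupied (modified_rule 2) \<omega> t"
    if yz: "y \<in> eventually_occupied (modified_rule 2) \<omega>" "z \<in> eventually_occupied (modified_rule 2) \<omega>" for y z
    using that occupied_mono_time[of _ _ "modified_rule 2" \<omega>] unfolding eventually_occupied_def
  proof -
    obtain s t where "y \<in> occupied (modified_rule 2) \<omega> s" "z \<in> occupied (modified_rule 2) \<omega> t"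
      using yz unfolding eventually_occupied_def by blast
    then show ?thesis using occupied_mono_time[of s "max s t" "modified_rule 2" \<omega>]
        occupied_mono_time[of t "max s t" "modified_rule 2" \<omega>] by (intro exI[of _ "max s t"]) auto
  qed
  obtain i j y z where ij: "i \<noteq> j" "y = x - axis i 1 \<or> y = x + axis i 1" "z = x - axis j 1 \<or> z = x + axis j 1"
    and yz: "y \<in> eventually_occupied (modified_rule 2) \<omega>" "z \<in> eventually_occupied (modified_rule 2) \<omega>"
    using assms(1) unfolding modified_rule_2 by blast
  obtain t where t: "y \<in> occupied (modified_rule 2) \<omega> t" "z \<in> occupied (modified_rule 2) \<omega> t"
    using common[OF yz] by blast
  have "modified_rule 2 (occupied (modified_rule 2) \<omega> t) x"
    
    by (rule modified_rule_2[THEN iffD2], rule exI[of _ i], rule exI[of _ j]) (use ij t in auto)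
  then have "x \<in> occupied (modified_rule 2) \<omega> (Suc t)" using assms(2) by simp
  then show ?thesis unfolding eventually_occupied_def by blast
qed

lemma initially_in_eventually: "\<omega> x = Initially_Occupied \<Longrightarrow> x \<in> eventually_occupied R \<omega>"
  unfolding eventually_occupied_def by (intro UN_I[of 0]) auto

section \<open>Measurability of the events\<close>

lemma space_config_measure [simp]: "space (config_measure p q) = UNIV"
  by (simp add: config_measure_def space_PiM)

lemma pred_config_measure [measurable]:
  "Measurable.pred (config_measure p q) (\<lambda>\<omega>. P (\<omega> x))"
proof -
  have "(\<lambda>\<omega>. \<omega> x) \<in> measurable (config_measure p q) (measure_pmf (site_pmf p q))"
    unfolding config_measure_def by (rule measurable_component_singleton) simp
  then have "(\<lambda>\<omega>. \<omega> x) \<in> measurable (config_measure p q) (count_space UNIV)"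
    by (simp cong: measurable_cong_sets)
  then show ?thesis by (rule measurable_compose) simp
qed

lemma pred_standard_rule:
  assumes [measurable]: "\<And>y. Measurable.pred M (\<lambda>\<omega>. y \<in> A \<omega>)"
  shows "Measurable.pred M (\<lambda>\<omega>. standard_rule 2 (A \<omega>) (x :: ('d::finite) site))"
  unfolding standard_rule_2 by measurable

lemma pred_modified_rule:
  assumes [measurable]: "\<And>y. Measurable.pred M (\<lambda>\<omega>. y \<in> A \<omega>)"
  shows "Measurable.pred M (\<lambda>\<omega>. modified_rule 2 (A \<omega>) (x :: ('d::finite) site))"
  unfolding modified_rule_2 by measurable

lemma pred_eventually_occupied:
  fixes R :: "('d::finite) rule"
  assumes rule: "\<And>A x. (\<And>y. Measurable.pred (config_measure p q :: 'd config measure) (\<lambda>\<omega>. y \<in> A \<omega>)) \<Longrightarrow>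
     Measurable.pred (config_measure p q) (\<lambda>\<omega>. R (A \<omega>) x)"
  shows "Measurable.pred (config_measure p q) (\<lambda>\<omega>. x \<in> eventually_occupied R \<omega>)"
proof -
  have [measurable]: "Measurable.pred (config_measure p q) (\<lambda>\<omega>. x \<in> occupied R \<omega> t)" for t x
  proof (induction t arbitrary: x)
    case 0 show ?case by simp
  next
    case (Suc t)
    note [measurable] = Suc
    have [measurable]: "Measurable.pred (config_measure p q) (\<lambda>\<omega>. R (occupied R \<omega> t) x)"
      by (rule rule) (rule Suc)
    show ?case by simp
  qed
  show ?thesis unfolding eventually_occupied_def by simp
qed

lemma connected_sites_cluster:
  "connected_sites {y. (x, y) \<in> {(a, b). a \<in> A \<and> b \<in> A \<and> neighbors a b}\<^sup>*}" (is "connected_sites ?S")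
proof -
  let ?E = "{(a, b). a \<in> A \<and> b \<in> A \<and> neighbors a b}"
  let ?F = "{(a, b). a \<in> ?S \<and> b \<in> ?S \<and> neighbors a b}"
  have sym: "sym ?F" by (auto simp: sym_def neighbors_commute)
  have from_x: "(x, y) \<in> ?F\<^sup>*" if "(x, y) \<in> ?E\<^sup>*" for y
    using that
  proof (induction rule: rtrancl_induct)
    case (step y z)
    then have "(y, z) \<in> ?F" by (auto intro: rtrancl_into_rtrancl)
    with step.IH show ?case by (rule rtrancl_into_rtrancl)
  qed simp
  have "(u, v) \<in> ?F\<^sup>*" if "u \<in> ?S" "v \<in> ?S" for u v
    using from_x[of u] from_x[of v] that sym_rtrancl[OF sym] by (auto dest: symD intro: rtrancl_trans)
  then show ?thesis unfolding connected_sites_def by blast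
qed

text \<open>The quantifier over sets \<open>S\<close> is uncountable. Taking the whole cluster of
  \<open>x\<close> for \<open>S\<close> leaves quantifiers over naturals and sites and connections
  of a fixed length \<open>k\<close>, whose measurability follows by induction on
  \<open>k\<close>.\<close>

lemma in_infinite_occupied_set_iff:
  "in_infinite_occupied_set R \<omega> x \<longleftrightarrow> x \<in> eventually_occupied R \<omega> \<and>
     (\<forall>n. \<exists>y. n \<le> to_nat y \<and> (\<exists>k. (x, y) \<in> {(a, b). a \<in> eventually_occupied R \<omega> \<and>
        b \<in> eventually_occupied R \<omega> \<and> neighbors a b} ^^ k))"
proof -
  let ?A = "eventually_occupied R \<omega>"
  let ?E = "\<lambda>A. {(a, b). a \<in> A \<and> b \<in> A \<and> neighbors a b}"
  have inf: "infinite S \<longleftrightarrow> (\<forall>n. \<exists>y. n \<le> to_nat y \<and> y \<in> S)" for S :: "'a site set"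
  proof -
    have "infinite S \<longleftrightarrow> infinite (to_nat ` S)" by (simp add: finite_image_iff)
    also have "\<dots> \<longleftrightarrow> (\<forall>m. \<exists>n\<ge>m. n \<in> to_nat ` S)" by (rule infinite_nat_iff_unbounded_le)
    finally show ?thesis by blast
  qed
  have "in_infinite_occupied_set R \<omega> x \<longleftrightarrow> x \<in> ?A \<and> infinite {y. (x, y) \<in> (?E ?A)\<^sup>*}"
  proof
    assume "in_infinite_occupied_set R \<omega> x"
    then obtain S where S: "x \<in> S" "infinite S" "connected_sites S" "S \<subseteq> ?A"
      unfolding in_infinite_occupied_set_def by blast
    have "?E S \<subseteq> ?E ?A" using S(4) by blast
    then have "(?E S)\<^sup>* \<subseteq> (?E ?A)\<^sup>*" by (rule rtrancl_mono)
    then have "S \<subseteq> {y. (x, y) \<in> (?E ?A)\<^sup>*}" using S(1,3) unfolding connected_sites_def by blast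
    with S show "x \<in> ?A \<and> infinite {y. (x, y) \<in> (?E ?A)\<^sup>*}" using finite_subset by blast
  next
    assume *: "x \<in> ?A \<and> infinite {y. (x, y) \<in> (?E ?A)\<^sup>*}"
    have "{y. (x, y) \<in> (?E ?A)\<^sup>*} \<subseteq> ?A" using * by (auto elim: rtranclE)
    with * show "in_infinite_occupied_set R \<omega> x" unfolding in_infinite_occupied_set_def
      by (intro exI[of _ "{y. (x, y) \<in> (?E ?A)\<^sup>*}"] conjI connected_sites_cluster) auto
  qed
  then show ?thesis unfolding inf rtrancl_power by simp
qed

lemma pred_in_infinite_occupied_set:
  assumes [measurable]: "\<And>x. Measurable.pred M (\<lambda>\<omega>. (x :: ('d::finite) site) \<in> eventually_occupied R \<omega>)"
  shows "Measurable.pred M (\<lambda>\<omega>. in_infinite_occupied_set R \<omega> (x :: ('d::finite) site))"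
proof -
  have [measurable]: "Measurable.pred M (\<lambda>\<omega>. (x, y) \<in> {(a, b). a \<in> eventually_occupied R \<omega> \<and>
        b \<in> eventually_occupied R \<omega> \<and> neighbors a b} ^^ k)" for k and y :: "'d site"
  proof (induction k arbitrary: y)
    case (Suc k)
    note [measurable] = Suc
    show ?case by (simp add: relcomp_unfold)
  qed simp
  show ?thesis unfolding in_infinite_occupied_set_iff by measurable
qed

section \<open>Growth on a sheet\<close>

definition coordinate_sites :: "('d::finite) set \<Rightarrow> 'd site set" where
  "coordinate_sites I = {v. \<forall>i. i \<notin> I \<longrightarrow> v $ i = 0}"

definition box :: "('d::finite) set \<Rightarrow> ('d \<Rightarrow> int) \<Rightarrow> ('d \<Rightarrow> int) \<Rightarrow> 'd site set" where
  "box I a b = {v \<in> coordinate_sites I. \<forall>i\<in>I. a i \<le> v $ i \<and> v $ i \<le> b i}"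

lemma coordinate_sites_shift:
  assumes "i \<in> I"
  shows "v + axis i c \<in> coordinate_sites I \<longleftrightarrow> v \<in> coordinate_sites I"
    "v - axis i c \<in> coordinate_sites I \<longleftrightarrow> v \<in> coordinate_sites I"
  using assms by (auto simp: coordinate_sites_def axis_component)

lemma coordinate_sites_uminus [simp]: "- v \<in> coordinate_sites I \<longleftrightarrow> v \<in> coordinate_sites I"
  by (auto simp: coordinate_sites_def)

lemma finite_box: "finite (box I a b)"
proof -
  have "box I a b \<subseteq> vec_lambda ` (\<Pi>\<^sub>E i\<in>UNIV. if i \<in> I then {a i..b i} else {0})"
  proof
    fix y assume "y \<in> box I a b"
    then have "vec_nth y \<in> (\<Pi>\<^sub>E i\<in>UNIV. if i \<in> I then {a i..b i} else {0})"
      by (auto simp: PiE_def Pi_def box_def coordinate_sites_def)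
    then show "y \<in> vec_lambda ` (\<Pi>\<^sub>E i\<in>UNIV. if i \<in> I then {a i..b i} else {0})"
      by (rule image_eqI[rotated]) (simp add: vec_nth_inverse)
  qed
  then show ?thesis by (rule finite_subset) (auto intro!: finite_PiE)
qed

lemma card_3_memberE:
  assumes "card I = 3" "i \<in> I"
  obtains j k where "I = {i, j, k}" "i \<noteq> j" "i \<noteq> k" "j \<noteq> k"
proof -
  obtain x y z where "I = {x, y, z}" "x \<noteq> y" "y \<noteq> z" "x \<noteq> z" using assms(1) card_3_iff[of I] by blast
  then have "\<exists>j k. I = {i, j, k} \<and> i \<noteq> j \<and> i \<noteq> k \<and> j \<noteq> k" using assms(2) by blast
  then show ?thesis using that by blast
qed

text \<open>Think of \<^term>\<open>h\<close> as the height above a plane transverse to \<open>(1, 1, 1)\<close>. Growth across an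
  edge of a box needs the level sets to stay close to that plane, which is the condition
  \<open>2 * 9 > 11\<close> on the slopes. The sheet has thickness 40, more than three times the largest
  slope, so that its slices in neighbouring coordinate planes overlap in a connected set.\<close>

locale sheet =
  fixes I :: "('d::finite) set" and h :: "'d site \<Rightarrow> int"
  assumes card_I: "card I = 3"
    and incr: "i \<in> I \<Longrightarrow> h v + 9 \<le> h (v + axis i 1) \<and> h (v + axis i 1) \<le> h v + 11"
begin

definition surface :: "'d site set" where
  "surface = {v \<in> coordinate_sites I. 0 \<le> h v \<and> h v \<le> 40}"

text \<open>Growth is expressed as closure rather than in time. The eventually occupied set is
  closed in this sense once the surface has no closed site, so the geometric lemmas apply to it
  directly.\<close>

definition spreads :: "'d site set \<Rightarrow> bool" where
  "spreads A \<longleftrightarrow> (\<forall>v\<in>surface. modified_rule 2 A v \<longrightarrow> v \<in> A)"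

lemma spreadsD:
  assumes "spreads A" "v \<in> surface" "i \<noteq> j" "v - axis i 1 \<in> A \<or> v + axis i 1 \<in> A"
    "v - axis j 1 \<in> A \<or> v + axis j 1 \<in> A"
  shows "v \<in> A"
  using assms unfolding spreads_def modified_rule_2 by blast

lemma decr: "i \<in> I \<Longrightarrow> h v - 11 \<le> h (v - axis i 1) \<and> h (v - axis i 1) \<le> h v - 9"
  using incr[of i "v - axis i 1"] by simp

lemma axis_Suc: "v + axis i (int (Suc n)) = (v + axis i (int n)) + axis i 1"
  "v - axis i (int (Suc n)) = (v - axis i (int n)) - axis i 1"
  by (auto simp: vec_eq_iff axis_component)

lemma incr_nat:
  assumes "i \<in> I"
  shows "h v + 9 * int n \<le> h (v + axis i (int n)) \<and> h (v + axis i (int n)) \<le> h v + 11 * int n"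
proof (induction n)
  case 0
  have zero: "axis i (0::int) = 0" by (simp add: vec_eq_iff axis_component)
  show ?case by (simp add: zero)
next
  case (Suc n)
  then show ?case using incr[OF assms, of "v + axis i (int n)"] unfolding axis_Suc by simp
qed

text \<open>A negative \<open>c\<close> swaps the roles of the slopes 9 and 11, hence
  \<open>min\<close> and \<open>max\<close>.\<close>

lemma incr_axis:
  assumes "i \<in> I"
  shows "h v + min (9 * c) (11 * c) \<le> h (v + axis i c) \<and> h (v + axis i c) \<le> h v + max (9 * c) (11 * c)"
proof (cases "0 \<le> c")
  case True
  then obtain n where "c = int n" using nonneg_int_cases by blast
  then show ?thesis using incr_nat[OF assms, of v n] by simp
next
  case False
  then obtain n where n: "c = - int n" by (metis int_cases2 of_nat_0_le_iff)
  have "axis i c + axis i (int n) = 0" using n by (simp add: vec_eq_iff axis_component)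
  then have "v + axis i c + axis i (int n) = v" by (simp add: add.assoc)
  then show ?thesis using incr_nat[OF assms, of "v + axis i c" n] n by (simp only:) simp
qed

lemma site_decompose:
  assumes "u \<in> coordinate_sites I" "w \<in> coordinate_sites I" "I = {i, j, k}" "i \<noteq> j" "i \<noteq> k" "j \<noteq> k"
  shows "w = u + axis i (w $ i - u $ i) + axis j (w $ j - u $ j) + axis k (w $ k - u $ k)"
  using assms by (auto simp: vec_eq_iff axis_component coordinate_sites_def)

lemma height_mono:
  assumes "u \<in> coordinate_sites I" "w \<in> coordinate_sites I" "\<And>i. i \<in> I \<Longrightarrow> u $ i \<le> w $ i"
  shows "h u \<le> h w"
proof -
  obtain i j k where I: "I = {i, j, k}" "i \<noteq> j" "i \<noteq> k" "j \<noteq> k"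
    using card_I card_3_iff[of I] by metis
  have *: "h v \<le> h (v + axis l (w $ l - u $ l))" if "l \<in> I" for v l
    using incr_axis[OF that, of v "w $ l - u $ l"] assms(3)[OF that] by simp
  have "h u \<le> h (u + axis i (w $ i - u $ i))" using * I(1) by blast
  also have "\<dots> \<le> h (u + axis i (w $ i - u $ i) + axis j (w $ j - u $ j))" using * I(1) by blast
  also have "\<dots> \<le> h (u + axis i (w $ i - u $ i) + axis j (w $ j - u $ j) + axis k (w $ k - u $ k))"
    using * I(1) by blast
  also have "\<dots> = h w" using site_decompose[OF assms(1,2) I] by simp
  finally show ?thesis .
qed

text \<open>A site of the new slice whose predecessor lies in the sheet has an occupied neighbour there,
  so from the seed occupation spreads through all such sites. A remaining site \<open>v\<close> sits near the
  lower boundary of the sheet, and both \<open>v + axis j 1\<close> and \<open>v + axis k 1\<close> are closer to having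
  a predecessor in the sheet; the edge condition keeps these two sites inside the box.\<close>

lemma grow_up:
  assumes spr: "spreads A" and sub: "surface \<inter> box I a b \<subseteq> A" and i: "i \<in> I" and ab: "a i \<le> b i"
    and edge: "\<And>v l. v \<in> box I a b \<Longrightarrow> v $ i = b i \<Longrightarrow> l \<in> I \<Longrightarrow> l \<noteq> i \<Longrightarrow> v $ l = b l \<Longrightarrow> 0 \<le> h v"
    and seed: "s \<in> A" "s \<in> surface" "s \<in> box I a (b(i := b i + 1))" "s $ i = b i + 1" "0 \<le> h (s - axis i 1)"
  shows "surface \<inter> box I a (b(i := b i + 1)) \<subseteq> A"
proof -
  let ?e = "axis i (1::int)"
  let ?F = "{v \<in> surface. v \<in> box I a (b(i := b i + 1)) \<and> v $ i = b i + 1}"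
  let ?O = "{v \<in> ?F. 0 \<le> h (v - ?e)}"
  obtain j k where I: "I = {i, j, k}" "i \<noteq> j" "i \<noteq> k" "j \<noteq> k"
    using card_3_memberE[OF card_I i] .
  have below_box: "v - ?e \<in> box I a b" if "v \<in> ?F" for v
    using that i ab by (auto simp: box_def coordinate_sites_shift axis_component split: if_splits)
  have below: "v - ?e \<in> A" if "v \<in> ?O" for v
  proof -
    have "v - ?e \<in> surface"
      using that decr[OF i, of v] i by (auto simp: surface_def coordinate_sites_shift)
    then show ?thesis using below_box that sub by blast
  qed
  have plus: "u + axis l 1 \<in> ?F" if "u \<in> ?F" "l \<in> I" "l \<noteq> i" "u $ l < b l" "h (u + axis l 1) \<le> 40" for u l
    using that incr[OF that(2), of u]
    by (auto simp: box_def surface_def coordinate_sites_shift axis_component)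
  have plus_O: "u + axis l 1 \<in> ?O" if "u \<in> ?O" "l \<in> I" "l \<noteq> i" "u $ l < b l" "h (u + axis l 1) \<le> 40" for u l
    using plus[OF _ that(2-5)] that(1) incr[OF that(2), of "u - ?e"] by (simp add: algebra_simps)
  have minus_O: "u - axis l 1 \<in> ?O" if "u \<in> ?O" "l \<in> I" "l \<noteq> i" "a l < u $ l" "0 \<le> h (u - axis l 1 - ?e)" for u l
    using that decr[OF that(2), of u] decr[OF i, of "u - axis l 1"]
    by (auto simp: box_def surface_def coordinate_sites_shift axis_component)
  have range: "a l \<le> u $ l \<and> u $ l \<le> b l" if "u \<in> ?F" "l \<in> I" "l \<noteq> i" for u l
    using that by (auto simp: box_def)
  have F_sites: "u \<in> coordinate_sites I" if "u \<in> ?F" for u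
    using that by (auto simp: surface_def)
  \<comment> \<open>Connectedness of \<open>?O\<close>: the occupied site \<open>u\<close> is moved
    towards \<open>v\<close> inside \<open>?O\<close>, and every move shortens the l1 distance in
    the \<open>j\<close>, \<open>k\<close> plane by one.\<close>
  have overlap: "v \<in> A" if "v \<in> ?O" "u \<in> ?O" "u \<in> A" "nat (\<bar>u $ j - v $ j\<bar> + \<bar>u $ k - v $ k\<bar>) = n" for u v n
    using that(2-)
  proof (induction n arbitrary: u)
    case 0
    have "u $ l = v $ l" for l
    proof (cases "l \<in> I")
      case True
      then show ?thesis using 0 that(1) I by auto
    next
      case False
      then show ?thesis using 0 that(1) by (auto simp: surface_def coordinate_sites_def)
    qed
    then have "u = v" by (simp add: vec_eq_iff)
    with 0 show ?case by simp
  next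
    case (Suc n)
    have step: "v \<in> A" if u': "u' \<in> ?O" "u' = u + axis l 1 \<or> u' = u - axis l 1" "l = j \<or> l = k"
      "\<bar>u' $ j - v $ j\<bar> + \<bar>u' $ k - v $ k\<bar> + 1 = \<bar>u $ j - v $ j\<bar> + \<bar>u $ k - v $ k\<bar>" for u' l
    proof -
      have "u' \<in> A"
      proof (rule spreadsD[OF spr, of u' i l])
        show "u' - axis l 1 \<in> A \<or> u' + axis l 1 \<in> A" using u'(2) Suc.prems(2) by auto
      qed (use u' I below in auto)
      moreover have "nat (\<bar>u' $ j - v $ j\<bar> + \<bar>u' $ k - v $ k\<bar>) = n" using u'(4) Suc.prems(3) by linarith
      ultimately show ?thesis using Suc.IH u'(1) by blast
    qed
    \<comment> \<open>An upward move from height at most 29 ends at most at 29 + 11 = 40. A downward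
      move from height at least 30 keeps even the predecessor in the sheet, as 30 - 22 \<ge> 0. If
      the two coordinates do not differ in opposite senses, monotonicity compares the new heights
      with those at \<open>v\<close> instead. So some shortening move is always available.\<close>
    have toward: "v \<in> A" if l: "(l = j \<and> l' = k) \<or> (l = k \<and> l' = j)"
      and c: "(u $ l < v $ l \<and> (u $ l' \<le> v $ l' \<or> h u \<le> 29)) \<or> (v $ l < u $ l \<and> (v $ l' \<le> u $ l' \<or> 30 \<le> h u))" for l l'
    proof -
      have lI: "l \<in> I" "l \<noteq> i" "I = {i, l, l'}" "l \<noteq> l'" "l' \<noteq> i" using l I by auto
      have u: "u \<in> ?F" "v \<in> ?F" "0 \<le> h (u - ?e)" "0 \<le> h (v - ?e)" using Suc.prems(1) \<open>v \<in> ?O\<close> by blast+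
      show ?thesis
        using c
      proof
        assume c: "u $ l < v $ l \<and> (u $ l' \<le> v $ l' \<or> h u \<le> 29)"
        have "h (u + axis l 1) \<le> 40"
        proof (cases "h u \<le> 29")
          case True then show ?thesis using incr[OF lI(1), of u] by simp
        next
          case False
          have "h (u + axis l 1) \<le> h v"
            by (rule height_mono) (use c False lI u F_sites in \<open>auto simp: coordinate_sites_shift axis_component\<close>)
          then show ?thesis using u by (auto simp: surface_def)
        qed
        then have "u + axis l 1 \<in> ?O"
          using c range[OF u(2) lI(1,2)] by (intro plus_O[OF Suc.prems(1) lI(1,2)]) auto
        then show ?thesis by (rule step[of _ l]) (use l c I in \<open>auto simp: axis_component\<close>)
      next
        assume c: "v $ l < u $ l \<and> (v $ l' \<le> u $ l' \<or> 30 \<le> h u)"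
        have "0 \<le> h (u - axis l 1 - ?e)"
        proof (cases "30 \<le> h u")
          case True then show ?thesis using decr[OF lI(1), of u] decr[OF i, of "u - axis l 1"] by simp
        next
          case False
          have "h (v - ?e) \<le> h (u - axis l 1 - ?e)"
            by (rule height_mono)
              (use c False lI u F_sites i in \<open>auto simp: coordinate_sites_shift axis_component\<close>)
          then show ?thesis using u by simp
        qed
        then have "u - axis l 1 \<in> ?O"
          using c range[OF u(2) lI(1,2)] by (intro minus_O[OF Suc.prems(1) lI(1,2)]) auto
        then show ?thesis by (rule step[of _ l]) (use l c I in \<open>auto simp: axis_component\<close>)
      qed
    qed
    have "u $ j \<noteq> v $ j \<or> u $ k \<noteq> v $ k" using Suc.prems(3) by auto
    then have "(u $ j < v $ j \<and> (u $ k \<le> v $ k \<or> h u \<le> 29)) \<or> (v $ j < u $ j \<and> (v $ k \<le> u $ k \<or> 30 \<le> h u)) \<or>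
       (u $ k < v $ k \<and> (u $ j \<le> v $ j \<or> h u \<le> 29)) \<or> (v $ k < u $ k \<and> (v $ j \<le> u $ j \<or> 30 \<le> h u))"
      by presburger
    then show ?case using toward[of j k] toward[of k j] by blast
  qed
  have O_sub: "v \<in> A" if "v \<in> ?O" for v
    using overlap[OF that, of s] seed by blast
  have F_sub: "v \<in> A" if "v \<in> ?F" for v
    using that
  proof (induction "nat (- h (v - ?e))" arbitrary: v rule: less_induct)
    case less
    show ?case
    proof (cases "0 \<le> h (v - ?e)")
      case True then show ?thesis using O_sub less.prems by blast
    next
      case False
      have next_A: "v + axis l 1 \<in> A" if l: "l \<in> I" "l \<noteq> i" for l
      proof (rule less.hyps)
        have "v $ l \<noteq> b l"
          using edge[OF below_box[OF less.prems] _ l] l less.prems False by (auto simp: axis_component)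
        then have "v $ l < b l" using range[OF less.prems l] by simp
        \<comment> \<open>A predecessor below height 0 puts \<open>v\<close> below 11, far from the
          upper boundary.\<close>
        moreover have "h (v + axis l 1) \<le> 40" using incr[OF l(1), of v] decr[OF i, of v] False by simp
        ultimately show "v + axis l 1 \<in> ?F" using plus[OF less.prems l] by blast
        show "nat (- h (v + axis l 1 - ?e)) < nat (- h (v - ?e))"
          using incr[OF l(1), of "v - ?e"] False by (simp add: algebra_simps)
      qed
      show ?thesis
        by (rule spreadsD[OF spr, of v j k]) (use next_A I less.prems in auto)
    qed
  qed
  have "v \<in> A" if v: "v \<in> surface" "v \<in> box I a (b(i := b i + 1))" for v
  proof (cases "v $ i = b i + 1")
    case True then show ?thesis using F_sub v by blast
  next
    case False
    have "a l \<le> v $ l \<and> v $ l \<le> b l" if "l \<in> I" for l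
    proof -
      have "a l \<le> v $ l \<and> v $ l \<le> (b(i := b i + 1)) l" using v(2) that by (simp add: box_def)
      then show ?thesis using False by (cases "l = i") auto
    qed
    then have "v \<in> box I a b" using v(2) by (simp add: box_def)
    then show ?thesis using v sub by blast
  qed
  then show ?thesis by blast
qed

end

section \<open>Enlarging cubes layer by layer\<close>

context sheet
begin

definition cube :: "'d site \<Rightarrow> int \<Rightarrow> 'd site set" where
  "cube c n = {v \<in> coordinate_sites I. \<forall>l\<in>I. \<bar>v $ l - c $ l\<bar> \<le> n}"

text \<open>The lateral bounds are those of the cube, not of a partly enlarged box. Hence a seed
  stays valid whatever sides have already moved, and the face lies in the shell between consecutive
  cubes, away from any nucleus inside the cube.\<close>

definition up_face :: "'d site \<Rightarrow> int \<Rightarrow> 'd \<Rightarrow> 'd site set" where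
  "up_face c n i = {v \<in> coordinate_sites I. v $ i = c $ i + n + 1 \<and>
     (\<forall>l\<in>I. l \<noteq> i \<longrightarrow> \<bar>v $ l - c $ l\<bar> \<le> n) \<and> 0 \<le> h (v - axis i 1) \<and> h v \<le> 40}"

definition low_face :: "'d site \<Rightarrow> int \<Rightarrow> 'd \<Rightarrow> 'd site set" where
  "low_face c n i = {v \<in> coordinate_sites I. v $ i = c $ i - n - 1 \<and>
     (\<forall>l\<in>I. l \<noteq> i \<longrightarrow> \<bar>v $ l - c $ l\<bar> \<le> n) \<and> 0 \<le> h v \<and> h (v + axis i 1) \<le> 40}"

text \<open>These are the boxes passed through while the six sides of a cube are pushed out one at a
  time.\<close>

definition near_cube :: "'d site \<Rightarrow> int \<Rightarrow> ('d \<Rightarrow> int) \<Rightarrow> ('d \<Rightarrow> int) \<Rightarrow> bool" where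
  "near_cube c n a b \<longleftrightarrow> (\<forall>l\<in>I. c $ l - n - 1 \<le> a l \<and> a l \<le> c $ l - n \<and> c $ l + n \<le> b l \<and> b l \<le> c $ l + n + 1)"

lemma up_face_surface: "i \<in> I \<Longrightarrow> v \<in> up_face c n i \<Longrightarrow> v \<in> surface"
  using decr[of i v] by (auto simp: up_face_def surface_def)

lemma low_face_surface: "i \<in> I \<Longrightarrow> v \<in> low_face c n i \<Longrightarrow> v \<in> surface"
  using incr[of i v] by (auto simp: low_face_def surface_def)

lemma near_cube_edge:
  assumes c: "c \<in> surface" and n: "2 \<le> n" and nr: "near_cube c n a b" and i: "i \<in> I"
    and v: "v \<in> box I a b" "v $ i = b i" "l \<in> I" "l \<noteq> i" "v $ l = b l"
  shows "0 \<le> h v"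
proof -
  obtain j k where I: "I = {i, j, k}" "i \<noteq> j" "i \<noteq> k" "j \<noteq> k" using card_3_memberE[OF card_I i] .
  then obtain m where m: "I = {i, l, m}" "m \<noteq> i" "m \<noteq> l" using v(3,4) by blast
  \<comment> \<open>From \<open>c\<close>, two coordinates rise by n and the third falls by n + 1,
    so the height of \<open>w\<close> is at least 9 * n + 9 * n - 11 * (n + 1) = 7 * n - 11, which
    is nonnegative from n = 2 on. Every site of the edge dominates \<open>w\<close>
    coordinatewise.\<close>
  define w where "w = c + axis i n + axis l n + axis m (- n - 1)"
  have "h c + 9 * n \<le> h (c + axis i n)" using incr_axis[OF i, of c n] n by simp
  moreover have "h (c + axis i n) + 9 * n \<le> h (c + axis i n + axis l n)"
    using incr_axis[OF v(3), of "c + axis i n" n] n by simp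
  moreover have "h (c + axis i n + axis l n) - 11 * n - 11 \<le> h w"
    using incr_axis[of m "c + axis i n + axis l n" "- n - 1"] m n unfolding w_def by simp
  ultimately have "0 \<le> h w" using c n by (simp add: surface_def)
  also have "h w \<le> h v"
  proof (rule height_mono)
    have "c \<in> coordinate_sites I" using c by (simp add: surface_def)
    moreover have "m \<in> I" using m by blast
    ultimately show "w \<in> coordinate_sites I" using i v(3) by (simp add: w_def coordinate_sites_shift)
    show "v \<in> coordinate_sites I" using v by (simp add: box_def)
    have mI: "m \<in> I" using m by blast
    have low: "c $ i + n \<le> b i" "c $ l + n \<le> b l" "c $ m - n - 1 \<le> a m"
      using nr i v(3) mI unfolding near_cube_def by blast+
    have am: "a m \<le> v $ m" using v(1) mI by (simp add: box_def)
    fix t assume "t \<in> I"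
    then consider "t = i" | "t = l" | "t = m" using m by blast
    then show "w $ t \<le> v $ t"
    proof cases
      case 1 then show ?thesis using v(2,4) low m(2) by (simp add: w_def axis_component)
    next
      case 2 then show ?thesis using v(4,5) low m(3) by (simp add: w_def axis_component)
    next
      case 3 then show ?thesis using am low m(2,3) by (simp add: w_def axis_component)
    qed
  qed
  finally show ?thesis .
qed

lemma near_cube_grow_up:
  assumes c: "c \<in> surface" and n: "2 \<le> n" and nr: "near_cube c n a b" and i: "i \<in> I" "b i = c $ i + n"
    and A: "spreads A" "surface \<inter> box I a b \<subseteq> A" "up_face c n i \<inter> A \<noteq> {}"
  shows "surface \<inter> box I a (b(i := c $ i + n + 1)) \<subseteq> A"
proof -
  obtain s where s: "s \<in> up_face c n i" "s \<in> A" using A(3) by blast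
  have "surface \<inter> box I a (b(i := b i + 1)) \<subseteq> A"
  proof (rule grow_up[OF A(1,2) i(1), of s])
    have "a i \<le> c $ i - n" using nr i unfolding near_cube_def by blast
    then show "a i \<le> b i" using n i by simp
    show "0 \<le> h v" if "v \<in> box I a b" "v $ i = b i" "l \<in> I" "l \<noteq> i" "v $ l = b l" for v l
      using near_cube_edge[OF c n nr i(1) that] .
    have "a l \<le> s $ l \<and> s $ l \<le> (b(i := b i + 1)) l" if l: "l \<in> I" for l
    proof -
      have ab: "a l \<le> c $ l - n" "c $ l + n \<le> b l" using nr l unfolding near_cube_def by blast+
      show ?thesis
      proof (cases "l = i")
        case True then show ?thesis using s i ab n by (simp add: up_face_def)
      next
        case False
        then have "\<bar>s $ l - c $ l\<bar> \<le> n" using s l by (simp add: up_face_def)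
        then have "s $ l - c $ l \<le> n" "c $ l - s $ l \<le> n" by linarith+
        then show ?thesis using False ab by simp
      qed
    qed
    then show "s \<in> box I a (b(i := b i + 1))" using s by (simp add: box_def up_face_def)
  qed (use s i up_face_surface[OF i(1) s(1)] in \<open>auto simp: up_face_def\<close>)
  then show ?thesis using i by simp
qed

text \<open>Each line in direction \<open>j\<close> at depth \<open>t\<close> along \<open>k\<close>
  crosses height 0 within the lateral range of the cube, and the crossing shifted by one along
  \<open>i\<close> is a candidate. Different \<open>t\<close> give different \<open>k\<close>
  coordinates, so the number of candidates grows linearly in \<open>n\<close>.\<close>

lemma up_face_candidates:
  assumes c: "c \<in> surface" and n: "5 \<le> n" and i: "i \<in> I"
  shows "\<exists>S. S \<subseteq> up_face c n i \<and> finite S \<and> n \<le> 2 * int (card S)"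
proof -
  obtain j k where I: "I = {i, j, k}" "i \<noteq> j" "i \<noteq> k" "j \<noteq> k" using card_3_memberE[OF card_I i] .
  have jk: "j \<in> I" "k \<in> I" using I by auto
  define u where "u = (\<lambda>t y. c + axis i n + axis k (- t) + axis j y)"
  \<comment> \<open>With t \<le> n the line ends, at y = n, at height at least 7 * n. With n \<le> 2
    * t it starts, at y = -n, at height at most 40 - 5 * n / 2; for n \<ge> 5 this is below 29,
    which leaves room for one more slope of 11.\<close>
  define T where "T = {(n + 1) div 2..n}"
  have h_c: "0 \<le> h c" "h c \<le> 40" using c by (simp_all add: surface_def)
  have "\<exists>y. - n \<le> y \<and> y \<le> n \<and> 0 \<le> h (u t y) \<and> h (u t y + axis i 1) \<le> 40" if t: "t \<in> T" for t
  proof -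
    have t: "n \<le> 2 * t" "t \<le> n" using t by (auto simp: T_def)
    have b1: "h c + 9 * n - 11 * t \<le> h (c + axis i n + axis k (- t))"
      "h (c + axis i n + axis k (- t)) \<le> h c + 11 * n - 9 * t"
      using incr_axis[OF i, of c n] incr_axis[OF jk(2), of "c + axis i n" "- t"] n t by auto
    have top: "0 \<le> h (u t (- n + int (nat (2 * n))))"
      using b1 incr_axis[OF jk(1), of "c + axis i n + axis k (- t)" n] n t h_c by (simp add: u_def)
    have bot: "h (u t (- n)) \<le> h c + 2 * n - 9 * t"
      using b1 incr_axis[OF jk(1), of "c + axis i n + axis k (- t)" "- n"] n by (simp add: u_def)
    \<comment> \<open>The first nonnegative height after a negative one is at most 10, and the shift
      along \<open>i\<close> makes it at most 21.\<close>
    define m where "m = (LEAST m. 0 \<le> h (u t (- n + int m)))"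
    have m: "0 \<le> h (u t (- n + int m))" unfolding m_def by (rule LeastI) (rule top)
    have m_le: "m \<le> nat (2 * n)" unfolding m_def by (rule Least_le) (rule top)
    have "h (u t (- n + int m) + axis i 1) \<le> 40"
    proof (cases m)
      case 0
      then show ?thesis using bot incr[OF i, of "u t (- n)"] t n h_c by simp
    next
      case (Suc m')
      have "\<not> 0 \<le> h (u t (- n + int m'))"
        using not_less_Least[of m' "\<lambda>m. 0 \<le> h (u t (- n + int m))"] Suc unfolding m_def by simp
      moreover have "u t (- n + int m) = u t (- n + int m') + axis j 1"
        using Suc by (auto simp: u_def vec_eq_iff axis_component)
      ultimately show ?thesis
        using incr[OF jk(1), of "u t (- n + int m')"] incr[OF i, of "u t (- n + int m)"] by simp
    qed
    with m m_le n show ?thesis by (intro exI[of _ "- n + int m"]) auto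
  qed
  then obtain y where y: "\<And>t. t \<in> T \<Longrightarrow> - n \<le> y t \<and> y t \<le> n \<and> 0 \<le> h (u t (y t)) \<and> h (u t (y t) + axis i 1) \<le> 40"
    by metis
  define f where "f = (\<lambda>t. u t (y t) + axis i 1)"
  have f_k: "f t $ k = c $ k - t" for t using I by (simp add: f_def u_def axis_component)
  have "inj_on f T" by (rule inj_onI) (use f_k in \<open>metis diff_left_imp_eq\<close>)
  then have "card (f ` T) = card T" by (rule card_image)
  moreover have "n \<le> 2 * int (card T)" using n by (simp add: T_def)
  moreover have "f t \<in> up_face c n i" if t: "t \<in> T" for t
  proof -
    have t': "0 \<le> t" "t \<le> n" using t n by (auto simp: T_def)
    have "\<bar>f t $ l - c $ l\<bar> \<le> n" if "l \<in> I" "l \<noteq> i" for l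
    proof (cases "l = j")
      case True then show ?thesis using y[OF t] I by (simp add: f_def u_def axis_component abs_le_iff)
    next
      case False
      then have "l = k" using that I by blast
      then show ?thesis using t' by (simp add: f_k)
    qed
    moreover have "f t $ i = c $ i + n + 1" using I by (simp add: f_def u_def axis_component)
    moreover have "f t \<in> coordinate_sites I"
      using c i jk by (simp add: f_def u_def coordinate_sites_shift surface_def)
    moreover have "0 \<le> h (f t - axis i 1)" "h (f t) \<le> 40" using y[OF t] by (simp_all add: f_def)
    ultimately show ?thesis by (simp add: up_face_def)
  qed
  ultimately show ?thesis by (intro exI[of _ "f ` T"]) (auto simp: T_def)
qed

text \<open>Point reflection together with reversal of the height about 20 maps sheets to sheets and
  exchanges upper and lower faces. Downward growth is thereby the upward growth of the reflected
  sheet.\<close>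

lemma reflected: "sheet I (\<lambda>v. 40 - h (- v))"
proof
  show "card I = 3" by (rule card_I)
  fix i and v :: "'d site" assume "i \<in> I"
  then show "40 - h (- v) + 9 \<le> 40 - h (- (v + axis i 1)) \<and> 40 - h (- (v + axis i 1)) \<le> 40 - h (- v) + 11"
    using decr[of i "- v"] by simp
qed

lemma reflected_surface: "sheet.surface I (\<lambda>v. 40 - h (- v)) = uminus -` surface"
proof -
  interpret R: sheet I "\<lambda>v. 40 - h (- v)" by (rule reflected)
  show ?thesis by (auto simp: surface_def R.surface_def)
qed

lemma reflected_spreads:
  assumes "spreads A"
  shows "sheet.spreads I (\<lambda>v. 40 - h (- v)) (uminus -` A)"
proof -
  interpret R: sheet I "\<lambda>v. 40 - h (- v)" by (rule reflected)
  have "v \<in> uminus -` A" if v: "v \<in> R.surface" "modified_rule 2 (uminus -` A) v" for v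
  proof -
    obtain i j where "i \<noteq> j" "v - axis i 1 \<in> uminus -` A \<or> v + axis i 1 \<in> uminus -` A"
      "v - axis j 1 \<in> uminus -` A \<or> v + axis j 1 \<in> uminus -` A"
      using v(2) unfolding modified_rule_2 by blast
    moreover have "- (v + x) = - v - x" "- (v - x) = - v + x" for x :: "'d site" by simp_all
    ultimately show ?thesis using v(1) spreadsD[OF assms, of "- v" i j] unfolding reflected_surface
      by (simp only: vimage_eq) blast
  qed
  then show ?thesis unfolding R.spreads_def by blast
qed

lemma reflected_box: "uminus -` box I a b = box I (\<lambda>l. - b l) (\<lambda>l. - a l)"
  by (auto simp: box_def minus_le_iff le_minus_iff)

lemma reflected_up_face:
  "sheet.up_face I (\<lambda>v. 40 - h (- v)) (- c) n i = uminus -` low_face c n i"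
proof -
  interpret R: sheet I "\<lambda>v. 40 - h (- v)" by (rule reflected)
  have "\<bar>v $ l + c $ l\<bar> = \<bar>- v $ l - c $ l\<bar>" for v :: "'d site" and l by linarith
  then show ?thesis by (auto simp: R.up_face_def low_face_def)
qed

lemma near_cube_grow_down:
  assumes c: "c \<in> surface" and n: "2 \<le> n" and nr: "near_cube c n a b" and i: "i \<in> I" "a i = c $ i - n"
    and A: "spreads A" "surface \<inter> box I a b \<subseteq> A" "low_face c n i \<inter> A \<noteq> {}"
  shows "surface \<inter> box I (a(i := c $ i - n - 1)) b \<subseteq> A"
proof -
  interpret R: sheet I "\<lambda>v. 40 - h (- v)" by (rule reflected)
  let ?a = "\<lambda>l. - b l" and ?b = "\<lambda>l. - a l"
  have "R.surface \<inter> box I ?a (?b(i := (- c) $ i + n + 1)) \<subseteq> uminus -` A"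
  proof (rule R.near_cube_grow_up)
    show "- c \<in> R.surface" using c by (simp add: reflected_surface)
    show "R.near_cube (- c) n ?a ?b" using nr unfolding near_cube_def R.near_cube_def by fastforce
    show "R.spreads (uminus -` A)" by (rule reflected_spreads[OF A(1)])
    show "R.surface \<inter> box I ?a ?b \<subseteq> uminus -` A"
      using A(2) unfolding reflected_surface reflected_box[symmetric] by blast
    show "R.up_face (- c) n i \<inter> uminus -` A \<noteq> {}"
    proof -
      obtain s where "s \<in> low_face c n i" "s \<in> A" using A(3) by blast
      then have "- s \<in> R.up_face (- c) n i \<inter> uminus -` A" unfolding reflected_up_face by simp
      then show ?thesis by blast
    qed
  qed (use n i in auto)
  moreover have "?b(i := (- c) $ i + n + 1) = (\<lambda>l. - (a(i := c $ i - n - 1)) l)" by auto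
  ultimately have *: "uminus -` surface \<inter> uminus -` box I (a(i := c $ i - n - 1)) b \<subseteq> uminus -` A"
    unfolding reflected_box reflected_surface by simp
  show ?thesis
  proof
    fix v assume "v \<in> surface \<inter> box I (a(i := c $ i - n - 1)) b"
    then have "- v \<in> uminus -` surface \<inter> uminus -` box I (a(i := c $ i - n - 1)) b" by simp
    then show "v \<in> A" using * by fastforce
  qed
qed

lemma low_face_candidates:
  assumes c: "c \<in> surface" and n: "5 \<le> n" and i: "i \<in> I"
  shows "\<exists>S. S \<subseteq> low_face c n i \<and> finite S \<and> n \<le> 2 * int (card S)"
proof -
  interpret R: sheet I "\<lambda>v. 40 - h (- v)" by (rule reflected)
  have "- c \<in> R.surface" using c by (simp add: reflected_surface)
  from R.up_face_candidates[OF this n i] obtain S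
    where S: "S \<subseteq> uminus -` low_face c n i" "finite S" "n \<le> 2 * int (card S)"
    unfolding reflected_up_face by blast
  moreover have "card (uminus ` S) = card S" by (rule card_image) simp
  ultimately show ?thesis by (intro exI[of _ "uminus ` S"]) auto
qed

lemma cube_box: "cube c n = box I (\<lambda>l. c $ l - n) (\<lambda>l. c $ l + n)"
  by (auto simp: cube_def box_def abs_le_iff algebra_simps)

text \<open>Each box on the way is a \<open>near_cube\<close> whose next side to move is still at
  distance \<open>n\<close>, so the faces of the original cube supply all six seeds.\<close>

lemma cube_step:
  assumes c: "c \<in> surface" and n: "2 \<le> n" and A: "spreads A" "surface \<inter> cube c n \<subseteq> A"
    and faces: "\<And>i. i \<in> I \<Longrightarrow> up_face c n i \<inter> A \<noteq> {}" "\<And>i. i \<in> I \<Longrightarrow> low_face c n i \<inter> A \<noteq> {}"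
  shows "surface \<inter> cube c (n + 1) \<subseteq> A"
proof -
  obtain i j k where I: "I = {i, j, k}" "i \<noteq> j" "i \<noteq> k" "j \<noteq> k" using card_I card_3_iff[of I] by metis
  let ?a = "\<lambda>l. c $ l - n" and ?b = "\<lambda>l. c $ l + n"
  have upd: "near_cube c n (a(l := c $ l - n - 1)) b" "near_cube c n a (b(l := c $ l + n + 1))"
    if "near_cube c n a b" for a b l
    using that n by (auto simp: near_cube_def)
  have 0: "near_cube c n ?a ?b" "surface \<inter> box I ?a ?b \<subseteq> A" using A n by (auto simp: near_cube_def cube_box)
  let ?b1 = "?b(i := c $ i + n + 1)"
  have 1: "near_cube c n ?a ?b1" "surface \<inter> box I ?a ?b1 \<subseteq> A"
    using upd(2)[OF 0(1)] near_cube_grow_up[OF c n 0(1) _ _ A(1) 0(2) faces(1), of i] I by auto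
  let ?b2 = "?b1(j := c $ j + n + 1)"
  have 2: "near_cube c n ?a ?b2" "surface \<inter> box I ?a ?b2 \<subseteq> A"
    using upd(2)[OF 1(1)] near_cube_grow_up[OF c n 1(1) _ _ A(1) 1(2) faces(1), of j] I by auto
  let ?b3 = "?b2(k := c $ k + n + 1)"
  have 3: "near_cube c n ?a ?b3" "surface \<inter> box I ?a ?b3 \<subseteq> A"
    using upd(2)[OF 2(1)] near_cube_grow_up[OF c n 2(1) _ _ A(1) 2(2) faces(1), of k] I by auto
  let ?a1 = "?a(i := c $ i - n - 1)"
  have 4: "near_cube c n ?a1 ?b3" "surface \<inter> box I ?a1 ?b3 \<subseteq> A"
    using upd(1)[OF 3(1)] near_cube_grow_down[OF c n 3(1) _ _ A(1) 3(2) faces(2), of i] I by auto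
  let ?a2 = "?a1(j := c $ j - n - 1)"
  have 5: "near_cube c n ?a2 ?b3" "surface \<inter> box I ?a2 ?b3 \<subseteq> A"
    using upd(1)[OF 4(1)] near_cube_grow_down[OF c n 4(1) _ _ A(1) 4(2) faces(2), of j] I by auto
  let ?a3 = "?a2(k := c $ k - n - 1)"
  have 6: "near_cube c n ?a3 ?b3" "surface \<inter> box I ?a3 ?b3 \<subseteq> A"
    using upd(1)[OF 5(1)] near_cube_grow_down[OF c n 5(1) _ _ A(1) 5(2) faces(2), of k] I by auto
  have "cube c (n + 1) = box I ?a3 ?b3" using I unfolding cube_box box_def by auto
  with 6 show ?thesis by simp
qed

text \<open>A staircase along the sheet. Each move raises the difference of the coordinates
  \<open>i\<close> and \<open>j\<close> by one, so the path never returns. It provides both well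
  separated centres for nuclei and the infinite connected set.\<close>

lemma surface_path:
  assumes c: "c \<in> surface" and ij: "i \<in> I" "j \<in> I" "i \<noteq> j"
  obtains w where "w 0 = c" "\<And>n. w n \<in> surface" "\<And>n. neighbors (w n) (w (Suc n))"
    "\<And>n. w n $ i - w n $ j = c $ i - c $ j + int n"
proof -
  \<comment> \<open>A rise from height at most 20 ends at most at 31, a fall from at least 21 ends
    at least at 10.\<close>
  define step where "step = (\<lambda>v. if h v \<le> 20 then v + axis i (1::int) else v - axis j 1)"
  define w where "w = (\<lambda>n. (step ^^ n) c)"
  have w_Suc: "w (Suc n) = step (w n)" for n by (simp add: w_def)
  have "step v \<in> surface" if "v \<in> surface" for v
    using that ij incr[OF ij(1), of v] decr[OF ij(2), of v]
    by (auto simp: step_def surface_def coordinate_sites_shift)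
  then have "w n \<in> surface" for n by (induction n) (simp_all add: w_Suc, simp add: w_def c)
  moreover have "neighbors (w n) (w (Suc n))" for n
    by (simp add: w_Suc step_def neighbors_axis)
  moreover have "w n $ i - w n $ j = c $ i - c $ j + int n" for n
  proof (induction n)
    case (Suc n)
    have "step v $ i - step v $ j = v $ i - v $ j + 1" for v
      using ij(3) by (simp add: step_def axis_component)
    then show ?case using Suc by (simp add: w_Suc)
  qed (simp add: w_def)
  moreover have "w 0 = c" by (simp add: w_def)
  ultimately show ?thesis using that by blast
qed

end

lemma connected_sites_range:
  fixes w :: "nat \<Rightarrow> ('d::finite) site"
  assumes "\<And>n. neighbors (w n) (w (Suc n))"
  shows "connected_sites (range w)"
proof -
  let ?E = "{(a, b). a \<in> range w \<and> b \<in> range w \<and> neighbors a b}"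
  have "sym ?E" by (auto simp: sym_def neighbors_commute)
  then have sym: "sym (?E\<^sup>*)" by (rule sym_rtrancl)
  have "(w 0, w n) \<in> ?E\<^sup>*" for n
  proof (induction n)
    case (Suc n)
    have "(w n, w (Suc n)) \<in> ?E" using assms by blast
    with Suc show ?case by (rule rtrancl_into_rtrancl)
  qed simp
  then have "(w m, w n) \<in> ?E\<^sup>*" for m n using sym by (meson rtrancl_trans symD)
  then show ?thesis unfolding connected_sites_def by blast
qed

section \<open>Lipschitz sheets avoiding a set\<close>

definition level :: "('d::finite) site \<Rightarrow> int" where
  "level v = (\<Sum>i\<in>UNIV. v $ i)"

lemma level_axis: "level (v + axis i c) = level v + c" "level (v - axis i c) = level v - c"
  by (simp_all add: level_def sum.distrib sum_subtractf axis_component)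

text \<open>The largest \<open>m\<close> with \<open>reach C v m\<close> is the smallest nonnegative function \<open>g\<close> of \<open>v\<close> that is
  1-Lipschitz and for which no site of \<open>C\<close> has \<open>0 \<le> 10 * level v - g v \<le> 40\<close>: a site of \<open>C\<close> inside
  the sheet pushes the sheet above itself.\<close>

inductive reach :: "('d::finite) site set \<Rightarrow> 'd site \<Rightarrow> int \<Rightarrow> bool" for C where
  base: "m \<le> 0 \<Longrightarrow> reach C v m"
| up: "reach C v m \<Longrightarrow> reach C (v + axis i 1) (m - 1)"
| down: "reach C v m \<Longrightarrow> reach C (v - axis i 1) (m - 1)"
| jump: "reach C v m \<Longrightarrow> v \<in> C \<Longrightarrow> 10 * level v - 40 \<le> m \<Longrightarrow> reach C v (10 * level v + 1)"
| weaken: "reach C v m \<Longrightarrow> m' \<le> m \<Longrightarrow> reach C v m'"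

text \<open>The set \<open>D\<close> records the jumps. A second jump at the same site returns to the same height, so
  the loop between the two can be cut; hence distinct sites suffice, and as a jump
  gains at most 41, a path of length \<open>n\<close> to height \<open>m\<close> uses at least \<open>(m + n) / 41\<close> of them.\<close>

inductive reach_path :: "('d::finite) site set \<Rightarrow> 'd site \<Rightarrow> 'd site list \<Rightarrow> int \<Rightarrow> 'd site set \<Rightarrow> bool" for C where
  base: "reach_path C v [v] 0 {}"
| up: "reach_path C v l m D \<Longrightarrow> reach_path C (v + axis i 1) ((v + axis i 1) # l) (m - 1) D"
| down: "reach_path C v l m D \<Longrightarrow> reach_path C (v - axis i 1) ((v - axis i 1) # l) (m - 1) D"
| jump: "reach_path C v l m D \<Longrightarrow> v \<in> C \<Longrightarrow> v \<notin> D \<Longrightarrow> 10 * level v - 40 \<le> m \<Longrightarrow>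
    reach_path C v l (10 * level v + 1) (insert v D)"

text \<open>The path is cut just after its jump at \<open>c\<close>; the height there depends on
  \<open>c\<close> alone.\<close>

lemma reach_path_jumped:
  assumes "reach_path C v l m D" "c \<in> D"
  shows "\<exists>l D. reach_path C c l (10 * level c + 1) D"
  using assms by induction (auto intro: reach_path.jump)

lemma reach_imp_path:
  assumes "reach C v m"
  shows "m \<le> 0 \<or> (\<exists>m'\<ge>m. \<exists>l D. reach_path C v l m' D)"
  using assms
proof induction
  case (up v m i)
  then show ?case using reach_path.up[of C v _ _ _ i] by (metis diff_right_mono le_diff_eq linorder_linear
     add_0 order_trans le_add_same_cancel1 zero_le_one)
next
  case (down v m i)
  then show ?case using reach_path.down[of C v _ _ _ i] by (metis diff_right_mono le_diff_eq linorder_linear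
     add_0 order_trans le_add_same_cancel1 zero_le_one)
next
  case (jump v m)
  \<comment> \<open>If the height before the jump is nonpositive, the path restarts at
    \<open>v\<close> with height 0.\<close>
  obtain m' l D where p: "m \<le> m'" "reach_path C v l m' D"
    using jump.IH reach_path.base[of C v] by blast
  show ?case
  proof (cases "v \<in> D")
    case True
    then show ?thesis using reach_path_jumped[OF p(2)] by blast
  next
    case False
    then have "reach_path C v l (10 * level v + 1) (insert v D)"
      using reach_path.jump[OF p(2)] jump.hyps p(1) by simp
    then show ?thesis by blast
  qed
qed (auto intro: order_trans)

text \<open>A \<open>reach_path\<close> list has its current endpoint at the head, so walks are read
  backwards from the site whose height is in question. This fixes one end and makes them
  countable.\<close>

primrec walks :: "nat \<Rightarrow> ('d::finite) site \<Rightarrow> 'd site list set" where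
  "walks 0 v = {[v]}"
| "walks (Suc n) v = (\<Union>u \<in> range (\<lambda>i. v + axis i 1) \<union> range (\<lambda>i. v - axis i 1). (#) v ` walks n u)"

lemma finite_walks: "finite (walks n v)"
  by (induction n arbitrary: v) auto

lemma length_walks: "l \<in> walks n v \<Longrightarrow> length l = Suc n"
  by (induction n arbitrary: v l) auto

lemma card_walks: "card (walks n (v :: ('d::finite) site)) \<le> (2 * CARD('d)) ^ n"
proof (induction n arbitrary: v)
  case (Suc n)
  let ?U = "range (\<lambda>i. v + axis i 1) \<union> range (\<lambda>i. v - axis i 1)"
  have "card ?U \<le> card (range (\<lambda>i. v + axis i 1)) + card (range (\<lambda>i. v - axis i 1))" by (rule card_Un_le)
  also have "\<dots> \<le> 2 * CARD('d)"
    using card_image_le[OF finite_class.finite_UNIV, of "\<lambda>i. v + axis i 1"] card_image_le[OF finite_class.finite_UNIV, of "\<lambda>i. v - axis i 1"]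
    by simp
  finally have U: "card ?U \<le> 2 * CARD('d)" .
  have "card (walks (Suc n) v) \<le> (\<Sum>u\<in>?U. card ((#) v ` walks n u))"
    unfolding walks.simps by (rule card_UN_le) simp
  also have "\<dots> \<le> (\<Sum>u\<in>?U. (2 * CARD('d)) ^ n)"
    by (rule sum_mono) (use Suc card_image_le[OF finite_walks] order_trans in blast)
  also have "\<dots> \<le> (2 * CARD('d)) ^ Suc n" using U by simp
  finally show ?case .
qed simp

lemma reach_path_witness:
  assumes "reach_path C v l m D"
  shows "\<exists>n. l \<in> walks n v \<and> D \<subseteq> C \<and> D \<subseteq> set l \<and> m + int n \<le> 41 * int (card D)"
  using assms
proof induction
  case (base v)
  show ?case by (rule exI[of _ 0]) simp
next
  case (up v l m D i)
  then obtain n where n: "l \<in> walks n v \<and> D \<subseteq> C \<and> D \<subseteq> set l \<and> m + int n \<le> 41 * int (card D)" by blast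
  let ?w = "v + axis i 1"
  have "v = ?w - axis i 1" by simp
  then have "?w # l \<in> walks (Suc n) ?w" using n unfolding walks.simps by blast
  with n show ?case by (intro exI[of _ "Suc n"]) auto
next
  case (down v l m D i)
  then obtain n where n: "l \<in> walks n v \<and> D \<subseteq> C \<and> D \<subseteq> set l \<and> m + int n \<le> 41 * int (card D)" by blast
  let ?w = "v - axis i 1"
  have "v = ?w + axis i 1" by simp
  then have "?w # l \<in> walks (Suc n) ?w" using n unfolding walks.simps by blast
  with n show ?case by (intro exI[of _ "Suc n"]) auto
next
  case (jump v l m D)
  then obtain n where n: "l \<in> walks n v" "D \<subseteq> C" "D \<subseteq> set l" "m + int n \<le> 41 * int (card D)" by blast
  have "v \<in> set l" using n(1) by (cases n) auto
  moreover have "finite D" using n(3) finite_subset by auto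
  ultimately show ?case using n jump.hyps by (intro exI[of _ n]) auto
qed

text \<open>A witness for height \<open>m\<close> at \<open>v\<close> that involves finitely many
  sites for each \<open>n\<close>: it is measurable and open to a union bound over walks and subsets
  of their sites.\<close>

definition bad_walk :: "('d::finite) site \<Rightarrow> nat \<Rightarrow> nat \<Rightarrow> 'd site set \<Rightarrow> bool" where
  "bad_walk v m n C \<longleftrightarrow> (\<exists>l\<in>walks n v. \<exists>D\<in>Pow (set l). m + n \<le> 41 * card D \<and> D \<subseteq> C)"

lemma reach_imp_bad_walk:
  assumes "reach C v (int m)" "0 < m"
  shows "\<exists>n. bad_walk v m n C"
proof -
  obtain m' l D where p: "int m \<le> m'" "reach_path C v l m' D" using reach_imp_path[OF assms(1)] assms(2) by auto
  obtain n where n: "l \<in> walks n v" "D \<subseteq> C" "D \<subseteq> set l" "m' + int n \<le> 41 * int (card D)"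
    using reach_path_witness[OF p(2)] by blast
  have "m + n \<le> 41 * card D" using p(1) n(4) by linarith
  then show ?thesis using n unfolding bad_walk_def by blast
qed

text \<open>Let \<open>g\<close> be the largest reachable height: \<open>fin\<close> makes it finite
  and \<open>origin\<close> makes it 0 at the origin. The moves \<open>up\<close> and
  \<open>down\<close> make it 1-Lipschitz, so 10 * level - g has slopes between 9 and 11. A site of
  \<open>C\<close> at height at most 40 could jump, which forces its height to be at most
  -1.\<close>

lemma sheet_exists:
  fixes C :: "('d::finite) site set" and I :: "'d set"
  assumes origin: "\<And>n. \<not> bad_walk 0 1 n C" and fin: "\<And>v. \<exists>m>0. \<forall>n. \<not> bad_walk v m n C" and I: "card I = 3"
  obtains h where "sheet I h" "h 0 = 0" "\<And>v. v \<in> C \<Longrightarrow> \<not> (0 \<le> h v \<and> h v \<le> 40)"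
proof -
  have "\<exists>m. reach C v m \<and> \<not> reach C v (m + 1)" for v
  proof -
    have "\<exists>k. \<not> reach C v (int k)" using fin[of v] reach_imp_bad_walk by blast
    then obtain k where k: "\<not> reach C v (int k)" "\<And>k'. k' < k \<Longrightarrow> reach C v (int k')"
      using exists_least_iff[of "\<lambda>k. \<not> reach C v (int k)"] by blast
    have "k \<noteq> 0" using k(1) reach.base[of 0] by (cases k) auto
    then have "reach C v (int k - 1)" using k(2)[of "k - 1"] by (simp add: of_nat_diff)
    then show ?thesis using k(1) by (intro exI[of _ "int k - 1"]) auto
  qed
  then obtain g where g: "\<And>v. reach C v (g v)" "\<And>v. \<not> reach C v (g v + 1)" by metis
  have g_ge: "m \<le> g v" if "reach C v m" for v m
    using that g(2)[of v] reach.weaken[of C v m "g v + 1"] by linarith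
  define h where "h = (\<lambda>v. 10 * level v - g v)"
  have lip: "g v - 1 \<le> g (v + axis i 1)" "g (v + axis i 1) - 1 \<le> g v" for v i
    using g_ge[OF reach.up[OF g(1)[of v]]] g_ge[OF reach.down[OF g(1)[of "v + axis i 1"], of i]]
    by (simp_all only: add_diff_cancel)
  have arith: "10 * L - x + 9 \<le> 10 * (L + 1) - y \<and> 10 * (L + 1) - y \<le> 10 * L - x + 11"
    if "x - 1 \<le> y" "y - 1 \<le> x" for L x y :: int
    using that by auto
  have "sheet I h"
  proof
    show "h v + 9 \<le> h (v + axis i 1) \<and> h (v + axis i 1) \<le> h v + 11" for i v
      unfolding h_def level_axis by (rule arith) (rule lip)+
  qed (rule I)
  moreover have "\<not> reach C 0 1" using reach_imp_bad_walk[of C 0 1] origin by auto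
  then have "g 0 \<le> 0" using reach.weaken[OF g(1)[of 0], of 1] by linarith
  then have "h 0 = 0" using g_ge[OF reach.base[of 0 C 0]] by (simp add: h_def level_def)
  moreover have "\<not> (0 \<le> h v \<and> h v \<le> 40)" if "v \<in> C" for v
    using g_ge[OF reach.jump[OF g(1)[of v] that]] by (auto simp: h_def)
  ultimately show ?thesis using that by blast
qed

section \<open>Independent fields and the Peierls bound\<close>

definition bernoulli_field :: "real \<Rightarrow> ('a \<Rightarrow> bool) measure" where
  "bernoulli_field q = PiM UNIV (\<lambda>_. measure_pmf (bernoulli_pmf q))"

lemma product_prob_space_pmf: "product_prob_space (\<lambda>_. measure_pmf M)"
  by (simp add: product_prob_space_def product_prob_space_axioms_def product_sigma_finite_def
      prob_space_measure_pmf prob_space_imp_sigma_finite)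

lemma space_bernoulli_field [simp]: "space (bernoulli_field q) = UNIV"
  by (simp add: bernoulli_field_def space_PiM)

lemma prob_space_bernoulli_field: "prob_space (bernoulli_field q)"
  unfolding bernoulli_field_def by (intro prob_space_PiM) (rule prob_space_measure_pmf)

lemma measurable_bernoulli_field_iff:
  "f \<in> measurable M (bernoulli_field q) \<longleftrightarrow> (\<forall>x. Measurable.pred M (\<lambda>w. f w x))"
proof
  assume f: "f \<in> measurable M (bernoulli_field q)"
  show "\<forall>x. Measurable.pred M (\<lambda>w. f w x)"
  proof
    fix x
    have "(\<lambda>w. f w x) \<in> measurable M (measure_pmf (bernoulli_pmf q))"
      using f unfolding bernoulli_field_def by (rule measurable_compose) (rule measurable_component_singleton, simp)
    then show "Measurable.pred M (\<lambda>w. f w x)" by (simp cong: measurable_cong_sets)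
  qed
next
  assume "\<forall>x. Measurable.pred M (\<lambda>w. f w x)"
  then show "f \<in> measurable M (bernoulli_field q)"
    unfolding bernoulli_field_def by (intro measurable_PiM_single') (auto cong: measurable_cong_sets simp: PiE_def)
qed

lemma pred_bernoulli_field [measurable]: "Measurable.pred (bernoulli_field q) (\<lambda>\<kappa>. \<kappa> x)"
  by (rule measurable_bernoulli_field_iff[THEN iffD1, rule_format, OF measurable_ident_sets[OF refl]])

lemma emeasure_bernoulli_field_PiE:
  assumes "finite D"
  shows "emeasure (bernoulli_field q) {\<kappa>. \<forall>x\<in>D. \<kappa> x \<in> X x} = (\<Prod>x\<in>D. emeasure (bernoulli_pmf q) (X x))"
proof -
  interpret product_prob_space "\<lambda>_. measure_pmf (bernoulli_pmf q)" UNIV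
    by (rule product_prob_space_pmf)
  have eq: "{\<kappa>. \<forall>x\<in>D. \<kappa> x \<in> X x} = prod_emb UNIV (\<lambda>_. measure_pmf (bernoulli_pmf q)) D (\<Pi>\<^sub>E x\<in>D. X x)"
    by (auto simp: prod_emb_def space_PiM PiE_def Pi_def)
  show ?thesis unfolding bernoulli_field_def eq by (rule emeasure_PiM_emb) (use assms in auto)
qed

lemma distr_bernoulli_field_component:
  "distr (bernoulli_field q) (measure_pmf (bernoulli_pmf q)) (\<lambda>\<kappa>. \<kappa> x) = measure_pmf (bernoulli_pmf q)"
proof -
  interpret product_prob_space "\<lambda>_. measure_pmf (bernoulli_pmf q)" UNIV
    by (rule product_prob_space_pmf)
  show ?thesis unfolding bernoulli_field_def by (rule PiM_component) simp
qed

lemma measure_all: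
  assumes "finite D" "0 \<le> q" "q \<le> 1"
  shows "measure (bernoulli_field q) {\<kappa>. \<forall>x\<in>D. \<kappa> x} = q ^ card D"
  using emeasure_bernoulli_field_PiE[OF assms(1), of q "\<lambda>_. {True}"] assms(2,3)
  by (simp add: measure_def emeasure_pmf_single ennreal_power)

lemma measure_none:
  assumes "finite D" "0 \<le> q" "q \<le> 1"
  shows "measure (bernoulli_field q) {\<kappa>. \<forall>x\<in>D. \<not> \<kappa> x} = (1 - q) ^ card D"
  using emeasure_bernoulli_field_PiE[OF assms(1), of q "\<lambda>_. {False}"] assms(2,3)
  by (simp add: measure_def emeasure_pmf_single ennreal_power)

lemma indep_vars_bernoulli_field:
  "prob_space.indep_vars (bernoulli_field q) (\<lambda>_. measure_pmf (bernoulli_pmf q)) (\<lambda>x \<kappa>. \<kappa> x) UNIV"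
proof -
  let ?B = "\<lambda>_::'a. measure_pmf (bernoulli_pmf q)"
  interpret prob_space "bernoulli_field q" by (rule prob_space_bernoulli_field)
  have rv: "random_variable (?B x) (\<lambda>\<kappa>. \<kappa> x)" for x
    unfolding bernoulli_field_def by (rule measurable_component_singleton) simp
  have "distr (bernoulli_field q) (?B x) (\<lambda>\<kappa>. \<kappa> x) = ?B x" for x
    by (rule distr_bernoulli_field_component)
  moreover have "distr (bernoulli_field q) (Pi\<^sub>M UNIV ?B) (\<lambda>\<kappa>. \<lambda>x\<in>UNIV. \<kappa> x) = bernoulli_field q"
    unfolding bernoulli_field_def restrict_UNIV by (rule distr_id)
  ultimately have "distr (bernoulli_field q) (Pi\<^sub>M UNIV ?B) (\<lambda>\<kappa>. \<lambda>x\<in>UNIV. \<kappa> x) =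
      Pi\<^sub>M UNIV (\<lambda>x. distr (bernoulli_field q) (?B x) (\<lambda>\<kappa>. \<kappa> x))"
    by (simp add: bernoulli_field_def)
  then show ?thesis by (intro iffD2[OF indep_vars_iff_distr_eq_PiM] rv) simp_all
qed

definition depends_on :: "(('a \<Rightarrow> bool) \<Rightarrow> bool) \<Rightarrow> 'a set \<Rightarrow> bool" where
  "depends_on P J \<longleftrightarrow> (\<forall>\<kappa> \<kappa>'. (\<forall>x\<in>J. \<kappa> x = \<kappa>' x) \<longrightarrow> P \<kappa> = P \<kappa>')"

lemma measure_conj_independent:
  assumes P: "depends_on P J" "Measurable.pred (bernoulli_field q) P"
    and Q: "depends_on Q K" "Measurable.pred (bernoulli_field q) Q" and JK: "J \<inter> K = {}"
  shows "measure (bernoulli_field q) {\<kappa>. P \<kappa> \<and> Q \<kappa>} =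
    measure (bernoulli_field q) {\<kappa>. P \<kappa>} * measure (bernoulli_field q) {\<kappa>. Q \<kappa>}"
proof -
  let ?B = "\<lambda>_::'a. measure_pmf (bernoulli_pmf q)"
  interpret prob_space "bernoulli_field q" by (rule prob_space_bernoulli_field)
  let ?L = "\<lambda>b. if b then J else K"
  have "indep_vars (\<lambda>b. Pi\<^sub>M (?L b) ?B) (\<lambda>b \<kappa>. \<lambda>x\<in>?L b. \<kappa> x) (UNIV :: bool set)"
    by (rule indep_vars_restrict[OF indep_vars_bernoulli_field]) (use JK in \<open>auto simp: disjoint_family_on_def\<close>)
  then have "indep_var (Pi\<^sub>M J ?B) (\<lambda>\<kappa>. \<lambda>x\<in>J. \<kappa> x) (Pi\<^sub>M K ?B) (\<lambda>\<kappa>. \<lambda>x\<in>K. \<kappa> x)"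
    unfolding indep_var_def
    by (rule iffD1[OF indep_vars_cong, rotated -1]) (auto split: bool.split)
  note indep = this
  \<comment> \<open>Extending a partial field by \<open>False\<close> turns an event depending only
    on \<open>L\<close> into an event on the product over \<open>L\<close>, where independence of
    the restrictions applies.\<close>
  have ext: "{f \<in> space (Pi\<^sub>M L ?B). R (\<lambda>x. if x \<in> L then f x else False)} \<in> sets (Pi\<^sub>M L ?B)"
    if [measurable]: "Measurable.pred (bernoulli_field q) R" for R L
  proof -
    have "(\<lambda>f x. if x \<in> L then f x else False) \<in> measurable (Pi\<^sub>M L ?B) (bernoulli_field q)"
      unfolding measurable_bernoulli_field_iff
    proof
      fix x
      show "Measurable.pred (Pi\<^sub>M L ?B) (\<lambda>f. if x \<in> L then f x else False)"
      proof (cases "x \<in> L")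
        case True
        have "(\<lambda>f. f x) \<in> measurable (Pi\<^sub>M L ?B) (measure_pmf (bernoulli_pmf q))"
          by (rule measurable_component_singleton) (rule True)
        then show ?thesis using True by (simp cong: measurable_cong_sets)
      qed simp
    qed
    then show ?thesis by measurable
  qed
  have "prob ((\<lambda>\<kappa>. (\<lambda>x\<in>J. \<kappa> x, \<lambda>x\<in>K. \<kappa> x)) -`
      ({f \<in> space (Pi\<^sub>M J ?B). P (\<lambda>x. if x \<in> J then f x else False)} \<times>
       {f \<in> space (Pi\<^sub>M K ?B). Q (\<lambda>x. if x \<in> K then f x else False)}) \<inter> space (bernoulli_field q)) =
     prob ((\<lambda>\<kappa>. \<lambda>x\<in>J. \<kappa> x) -` {f \<in> space (Pi\<^sub>M J ?B). P (\<lambda>x. if x \<in> J then f x else False)} \<inter> space (bernoulli_field q)) *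
     prob ((\<lambda>\<kappa>. \<lambda>x\<in>K. \<kappa> x) -` {f \<in> space (Pi\<^sub>M K ?B). Q (\<lambda>x. if x \<in> K then f x else False)} \<inter> space (bernoulli_field q))"
    by (intro indep_varD[OF indep] ext P(2) Q(2))
  moreover have pre: "(\<lambda>x\<in>L. \<kappa> x) \<in> {f \<in> space (Pi\<^sub>M L ?B). R (\<lambda>x. if x \<in> L then f x else False)} \<longleftrightarrow> R \<kappa>"
    if R: "depends_on R L" for R L \<kappa>
  proof -
    have "R (\<lambda>x. if x \<in> L then restrict \<kappa> L x else False) = R \<kappa>"
      by (rule R[unfolded depends_on_def, rule_format]) simp
    then show ?thesis by (simp add: space_PiM)
  qed
  ultimately show ?thesis
    by (simp add: vimage_def pre[OF P(1), simplified] pre[OF Q(1), simplified])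
qed

lemma pred_bad_walk [measurable]:
  "Measurable.pred (bernoulli_field q) (\<lambda>\<kappa>. bad_walk (v :: ('d::finite) site) m n {x. \<kappa> x})"
proof -
  have [measurable]: "Measurable.pred (bernoulli_field q) (\<lambda>\<kappa>. D \<subseteq> {x. \<kappa> x})" for D :: "'d site set"
    unfolding subset_eq by simp
  show ?thesis unfolding bad_walk_def
    by (intro pred_intros_finite finite_walks) auto
qed

text \<open>There are at most (2 * d) ^ n walks and 2 ^ (n + 1) sets \<open>D\<close> on each, where
  d is the dimension. A set \<open>D\<close> is closed with probability q ^ card D \<le> r ^ (41 *
  card D) \<le> r ^ (m + n).\<close>

lemma measure_bad_walk:
  fixes v :: "('d::finite) site" and q r :: real
  assumes r: "0 \<le> r" "r \<le> 1" and q: "0 \<le> q" "q \<le> r ^ 41"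
  shows "measure (bernoulli_field q) {\<kappa>. bad_walk v m n {x. \<kappa> x}} \<le> 2 * r ^ m * (4 * CARD('d) * r) ^ n"
proof -
  interpret prob_space "bernoulli_field q :: ('d site \<Rightarrow> bool) measure" by (rule prob_space_bernoulli_field)
  have q1: "q \<le> 1" using q r by (meson order_trans power_le_one)
  let ?Ds = "\<lambda>l. {D \<in> Pow (set l). m + n \<le> 41 * card D}"
  let ?E = "\<lambda>D. {\<kappa> :: 'd site \<Rightarrow> bool. \<forall>x\<in>D. \<kappa> x}"
  have E_ev: "?E D \<in> events" for D
  proof -
    have "Measurable.pred (bernoulli_field q) (\<lambda>\<kappa> :: 'd site \<Rightarrow> bool. \<forall>x\<in>D. \<kappa> x)" by simp
    then show ?thesis by (simp add: pred_def)
  qed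
  have one: "prob (?E D) \<le> r ^ (m + n)" if D: "D \<in> ?Ds l" for l D
  proof -
    have "finite D" using D finite_subset by auto
    then have "prob (?E D) = q ^ card D" by (rule measure_all) (use q q1 in auto)
    also have "\<dots> \<le> (r ^ 41) ^ card D" using q by (intro power_mono) auto
    also have "\<dots> = r ^ (41 * card D)" by (simp add: power_mult)
    also have "\<dots> \<le> r ^ (m + n)" using D r by (intro power_decreasing) auto
    finally show ?thesis .
  qed
  have many: "prob (\<Union>D\<in>?Ds l. ?E D) \<le> 2 ^ Suc n * r ^ (m + n)" if l: "l \<in> walks n v" for l
  proof -
    have "prob (\<Union>D\<in>?Ds l. ?E D) \<le> (\<Sum>D\<in>?Ds l. prob (?E D))"
      by (rule finite_measure_subadditive_finite) (use E_ev in auto)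
    also have "\<dots> \<le> (\<Sum>D\<in>?Ds l. r ^ (m + n))" by (rule sum_mono) (rule one)
    also have "\<dots> = card (?Ds l) * r ^ (m + n)" by simp
    also have "card (?Ds l) \<le> card (Pow (set l))" by (rule card_mono) auto
    also have "\<dots> \<le> 2 ^ Suc n"
      using card_length[of l] length_walks[OF l] by (simp add: card_Pow power_increasing del: power_Suc)
    finally show ?thesis using r by (simp add: mult_right_mono)
  qed
  have "{\<kappa>. bad_walk v m n {x. \<kappa> x}} = (\<Union>l\<in>walks n v. \<Union>D\<in>?Ds l. ?E D)"
    by (auto simp: bad_walk_def)
  then have "prob {\<kappa>. bad_walk v m n {x. \<kappa> x}} \<le> (\<Sum>l\<in>walks n v. prob (\<Union>D\<in>?Ds l. ?E D))"
    using E_ev by (auto intro!: finite_measure_subadditive_finite finite_walks)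
  also have "\<dots> \<le> (\<Sum>l\<in>walks n v. 2 ^ Suc n * r ^ (m + n))" by (rule sum_mono) (rule many)
  also have "\<dots> = card (walks n v) * (2 ^ Suc n * r ^ (m + n))" by simp
  also have "\<dots> \<le> real ((2 * CARD('d)) ^ n) * (2 ^ Suc n * r ^ (m + n))"
    using r by (intro mult_right_mono of_nat_mono card_walks) auto
  also have "\<dots> = 2 * r ^ m * (2 * real CARD('d) * 2 * r) ^ n"
    by (simp only: power_mult_distrib power_add power_Suc of_nat_power of_nat_mult of_nat_numeral mult_ac)
  also have "2 * real CARD('d) * 2 * r = 4 * CARD('d) * r" by simp
  finally show ?thesis .
qed

text \<open>The condition on \<open>r\<close> makes the ratio of the previous bound at most 1 / 2,
  so summing over \<open>n\<close> costs a factor 2.\<close>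

lemma measure_ex_bad_walk:
  fixes v :: "('d::finite) site" and q r :: real
  assumes r: "0 \<le> r" "8 * CARD('d) * r \<le> 1" and q: "0 \<le> q" "q \<le> r ^ 41"
  shows "measure (bernoulli_field q) {\<kappa>. \<exists>n. bad_walk v m n {x. \<kappa> x}} \<le> 4 * r ^ m"
proof -
  interpret prob_space "bernoulli_field q :: ('d site \<Rightarrow> bool) measure" by (rule prob_space_bernoulli_field)
  have "1 \<le> real CARD('d)" by (simp add: Suc_le_eq)
  then have "1 * r \<le> 8 * CARD('d) * r" using r(1) by (intro mult_right_mono) linarith+
  then have r1: "r \<le> 1" using r by simp
  let ?E = "\<lambda>n. {\<kappa>. bad_walk v m n {x. \<kappa> x}}"
  have le: "prob (?E n) \<le> 2 * r ^ m * (1 / 2) ^ n" for n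
  proof -
    have "prob (?E n) \<le> 2 * r ^ m * (4 * CARD('d) * r) ^ n" by (rule measure_bad_walk[OF r(1) r1 q])
    also have "\<dots> \<le> 2 * r ^ m * (1 / 2) ^ n" using r by (intro mult_left_mono power_mono) auto
    finally show ?thesis .
  qed
  have sums: "(\<lambda>n. 2 * r ^ m * (1 / 2) ^ n) sums (2 * r ^ m * 2)"
    using geometric_sums[of "1 / 2 :: real"] by (intro sums_mult) simp
  have summ: "summable (\<lambda>n. prob (?E n))"
    by (rule summable_comparison_test'[OF sums_summable[OF sums]]) (use le in simp)
  have "?E n \<in> events" for n
  proof -
    have "Measurable.pred (bernoulli_field q) (\<lambda>\<kappa>. bad_walk v m n {x. \<kappa> x})" by measurable
    then show ?thesis by (simp add: pred_def)
  qed
  then have "prob (\<Union>n. ?E n) \<le> (\<Sum>n. prob (?E n))"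
    by (intro finite_measure_subadditive_countably summ) auto
  also have "\<dots> \<le> (\<Sum>n. 2 * r ^ m * (1 / 2) ^ n)" by (rule suminf_le[OF le summ sums_summable[OF sums]])
  also have "\<dots> = 4 * r ^ m" using sums_unique[OF sums] by simp
  finally show ?thesis by (simp add: Collect_ex_eq)
qed

definition sheet_config :: "(('d::finite) site \<Rightarrow> bool) \<Rightarrow> bool" where
  "sheet_config \<kappa> \<longleftrightarrow> (\<forall>n. \<not> bad_walk 0 1 n {x. \<kappa> x}) \<and> (\<forall>v. \<exists>m>0. \<forall>n. \<not> bad_walk v m n {x. \<kappa> x})"

lemma pred_sheet_config [measurable]: "Measurable.pred (bernoulli_field q) sheet_config"
  unfolding sheet_config_def by measurable

text \<open>Finiteness of the heights is almost sure, because 4 * r ^ m tends to 0 in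
  \<open>m\<close> at each of countably many sites. Only the demand at the origin, with m = 1, costs
  probability.\<close>

lemma measure_sheet_config:
  fixes q r :: real
  assumes r: "0 \<le> r" "8 * CARD('d::finite) * r \<le> 1" and q: "0 \<le> q" "q \<le> r ^ 41"
  shows "1 - 4 * r \<le> measure (bernoulli_field q) {\<kappa> :: 'd site \<Rightarrow> bool. sheet_config \<kappa>}"
proof -
  interpret prob_space "bernoulli_field q :: ('d site \<Rightarrow> bool) measure" by (rule prob_space_bernoulli_field)
  have "1 \<le> real CARD('d)" by (simp add: Suc_le_eq)
  then have "2 * r \<le> 8 * CARD('d) * r" using r(1) by (intro mult_right_mono) linarith+
  then have r1: "r < 1" using r(2) by linarith
  have ev: "{\<kappa>. \<exists>n. bad_walk v m n {x. \<kappa> x}} \<in> events" for v :: "'d site" and m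
  proof -
    have "Measurable.pred (bernoulli_field q) (\<lambda>\<kappa>. \<exists>n. bad_walk v m n {x. \<kappa> x})" by measurable
    then show ?thesis by (simp add: pred_def)
  qed
  have "AE \<kappa> in bernoulli_field q. \<exists>m>0. \<forall>n. \<not> bad_walk v m n {x. \<kappa> x}" for v :: "'d site"
  proof -
    let ?N = "{\<kappa>. \<forall>m>0. \<exists>n. bad_walk v m n {x. \<kappa> x}}"
    have N: "?N \<in> events"
    proof -
      have "Measurable.pred (bernoulli_field q) (\<lambda>\<kappa>. \<forall>m>0. \<exists>n. bad_walk v m n {x. \<kappa> x})" by measurable
      then show ?thesis by (simp add: pred_def)
    qed
    have bnd: "prob ?N \<le> 4 * r ^ Suc m" for m
    proof -
      have "prob ?N \<le> prob {\<kappa>. \<exists>n. bad_walk v (Suc m) n {x. \<kappa> x}}"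
        by (rule finite_measure_mono) (use ev in auto)
      also have "\<dots> \<le> 4 * r ^ Suc m" by (rule measure_ex_bad_walk[OF r q])
      finally show ?thesis .
    qed
    have lim: "(\<lambda>m. 4 * r ^ Suc m) \<longlonglongrightarrow> 4 * 0"
      by (intro tendsto_mult_left LIMSEQ_Suc LIMSEQ_power_zero) (use r r1 in simp)
    have "prob ?N \<le> 4 * 0" by (rule LIMSEQ_le_const[OF lim]) (use bnd in blast)
    then have "prob ?N \<le> 0" by simp
    then have "prob ?N = 0" using measure_nonneg[of _ ?N] by (intro antisym)
    then have "AE \<kappa> in bernoulli_field q. \<kappa> \<notin> ?N" using prob_eq_0[OF N] by simp
    then show ?thesis by simp
  qed
  then have "AE \<kappa> in bernoulli_field q. \<forall>v :: 'd site. \<exists>m>0. \<forall>n. \<not> bad_walk v m n {x. \<kappa> x}"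
    unfolding AE_all_countable by blast
  then have eq: "AE \<kappa> in bernoulli_field q. \<kappa> \<in> {\<kappa>. sheet_config \<kappa>} \<longleftrightarrow>
      \<kappa> \<in> UNIV - {\<kappa>. \<exists>n. bad_walk (0 :: 'd site) 1 n {x. \<kappa> x}}"
    by (rule AE_mp) (auto simp: sheet_config_def)
  have sc: "{\<kappa>. sheet_config \<kappa>} \<in> events" using pred_sheet_config by (simp add: pred_def)
  have "UNIV - {\<kappa>. \<exists>n. bad_walk (0 :: 'd site) 1 n {x. \<kappa> x}} \<in> events"
    using sets.compl_sets[OF ev[of 0 1]] by simp
  then have "prob {\<kappa>. sheet_config \<kappa>} = prob (UNIV - {\<kappa>. \<exists>n. bad_walk (0 :: 'd site) 1 n {x. \<kappa> x}})"
    by (rule finite_measure_eq_AE[OF eq sc])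
  also have "\<dots> = 1 - prob {\<kappa>. \<exists>n. bad_walk (0 :: 'd site) 1 n {x. \<kappa> x}}"
    using prob_compl[OF ev[of 0 1]] by simp
  finally show ?thesis using measure_ex_bad_walk[OF r q, of 0 1] by simp
qed

section \<open>Seeds on a sheet\<close>

lemma measure_none_independent:
  assumes "finite K" and X: "\<And>k. k \<in> K \<Longrightarrow> depends_on (X k) (J k)"
      "\<And>k. k \<in> K \<Longrightarrow> Measurable.pred (bernoulli_field q) (X k)"
    and disj: "\<And>k l. k \<in> K \<Longrightarrow> l \<in> K \<Longrightarrow> k \<noteq> l \<Longrightarrow> J k \<inter> J l = {}"
    and ge: "\<And>k. k \<in> K \<Longrightarrow> a \<le> measure (bernoulli_field q) {\<kappa>. X k \<kappa>}" and a: "a \<le> 1"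
  shows "measure (bernoulli_field q) {\<kappa>. \<forall>k\<in>K. \<not> X k \<kappa>} \<le> (1 - a) ^ card K"
  using assms(1) X disj ge
proof (induction K rule: finite_induct)
  case empty
  show ?case using prob_space.prob_le_1[OF prob_space_bernoulli_field] by simp
next
  case (insert k K)
  interpret prob_space "bernoulli_field q" by (rule prob_space_bernoulli_field)
  have Xk[measurable]: "Measurable.pred (bernoulli_field q) (X k)" using insert.prems(2) by blast
  have [measurable]: "Measurable.pred (bernoulli_field q) (\<lambda>\<kappa>. \<forall>k\<in>K. \<not> X k \<kappa>)"
    by (intro pred_intros_finite insert.hyps) (use insert.prems(2) in auto)
  have "prob {\<kappa>. \<forall>k\<in>insert k K. \<not> X k \<kappa>} = prob {\<kappa>. \<not> X k \<kappa> \<and> (\<forall>k\<in>K. \<not> X k \<kappa>)}" by simp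
  also have "\<dots> = prob {\<kappa>. \<not> X k \<kappa>} * prob {\<kappa>. \<forall>k\<in>K. \<not> X k \<kappa>}"
  proof (rule measure_conj_independent)
    show "depends_on (\<lambda>\<kappa>. \<not> X k \<kappa>) (J k)" using insert.prems(1)[of k] by (simp add: depends_on_def)
    show "depends_on (\<lambda>\<kappa>. \<forall>k\<in>K. \<not> X k \<kappa>) (\<Union>k\<in>K. J k)"
      using insert.prems(1) unfolding depends_on_def by (metis UN_I insertI2)
    show "J k \<inter> (\<Union>k\<in>K. J k) = {}" using insert.prems(3)[of k] insert.hyps by auto
  qed measurable
  also have "\<dots> \<le> (1 - a) * (1 - a) ^ card K"
  proof (rule mult_mono)
    have "{\<kappa>. X k \<kappa>} \<in> events" using Xk by (simp add: pred_def)
    then have "prob {\<kappa>. \<not> X k \<kappa>} = 1 - prob {\<kappa>. X k \<kappa>}" using prob_compl[of "{\<kappa>. X k \<kappa>}"]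
      by (simp add: Compl_eq_Diff_UNIV[symmetric] Collect_neg_eq)
    then show "prob {\<kappa>. \<not> X k \<kappa>} \<le> 1 - a" using insert.prems(4)[of k] by simp
    show "prob {\<kappa>. \<forall>k\<in>K. \<not> X k \<kappa>} \<le> (1 - a) ^ card K"
      by (rule insert.IH) (use insert.prems in auto)
  qed (use a in auto)
  finally show ?case using insert.hyps by simp
qed

context sheet
begin

definition faces_seeded :: "('d site \<Rightarrow> bool) \<Rightarrow> 'd site \<Rightarrow> nat \<Rightarrow> bool" where
  "faces_seeded \<kappa> c n \<longleftrightarrow>
     (\<forall>i\<in>I. (\<exists>v\<in>up_face c (int n) i. \<kappa> v) \<and> (\<exists>v\<in>low_face c (int n) i. \<kappa> v))"

lemma pred_faces_seeded [measurable]: "Measurable.pred (bernoulli_field p) (\<lambda>\<kappa>. faces_seeded \<kappa> c n)"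
  unfolding faces_seeded_def by simp

lemma surface_filled:
  assumes c: "c \<in> surface" and N: "2 \<le> N" and nucleus: "\<forall>v\<in>surface \<inter> cube c (int N). \<kappa> v"
    and faces: "\<And>n. N \<le> n \<Longrightarrow> faces_seeded \<kappa> c n"
    and A: "spreads A" "\<And>v. v \<in> surface \<Longrightarrow> \<kappa> v \<Longrightarrow> v \<in> A"
  shows "surface \<subseteq> A"
proof -
  have cubes: "surface \<inter> cube c (int n) \<subseteq> A" if "N \<le> n" for n
    using that
  proof (induction n rule: dec_induct)
    case base
    then show ?case using nucleus A(2) by blast
  next
    case (step n)
    have "surface \<inter> cube c (int n + 1) \<subseteq> A"
    proof (rule cube_step[OF c _ A(1) step.IH])
      show "up_face c (int n) i \<inter> A \<noteq> {}" "low_face c (int n) i \<inter> A \<noteq> {}" if "i \<in> I" for i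
        using faces[OF step.hyps(1)] that A(2) up_face_surface[OF that] low_face_surface[OF that]
        unfolding faces_seeded_def by blast+
    qed (use N step in auto)
    then show ?case by (simp add: add.commute)
  qed
  show ?thesis
  proof
    fix v assume v: "v \<in> surface"
    define n where "n = N + nat (\<Sum>l\<in>I. \<bar>v $ l - c $ l\<bar>)"
    have "\<bar>v $ l - c $ l\<bar> \<le> int n" if "l \<in> I" for l
      using member_le_sum[OF that, of "\<lambda>l. \<bar>v $ l - c $ l\<bar>"] by (simp add: n_def)
    then have "v \<in> cube c (int n)" using v by (simp add: cube_def surface_def)
    then show "v \<in> A" using v cubes[of n] by (auto simp: n_def)
  qed
qed

lemma faces_seeded_depends: "depends_on (\<lambda>\<kappa>. faces_seeded \<kappa> c n) (cube c (int n + 1) - cube c (int n))"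
proof -
  have "up_face c (int n) i \<subseteq> cube c (int n + 1) - cube c (int n)" if "i \<in> I" for i
    using that by (fastforce simp: up_face_def cube_def)
  moreover have "low_face c (int n) i \<subseteq> cube c (int n + 1) - cube c (int n)" if "i \<in> I" for i
    using that by (fastforce simp: low_face_def cube_def)
  ultimately show ?thesis unfolding depends_on_def faces_seeded_def by (metis subsetD)
qed

text \<open>Three directions with two faces each give the factor 6. A face has at least n / 2
  candidates, hence the square root.\<close>

lemma measure_faces_not_seeded:
  assumes c: "c \<in> surface" and n: "5 \<le> n" and p: "0 \<le> p" "p \<le> 1"
  shows "measure (bernoulli_field p) {\<kappa>. \<not> faces_seeded \<kappa> c n} \<le> 6 * sqrt (1 - p) ^ n"
proof -
  interpret prob_space "bernoulli_field p :: ('d site \<Rightarrow> bool) measure" by (rule prob_space_bernoulli_field)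
  let ?s = "sqrt (1 - p)"
  have ev: "{\<kappa>. \<forall>v\<in>S. \<not> \<kappa> v} \<in> events" for S :: "'d site set"
  proof -
    have "Measurable.pred (bernoulli_field p) (\<lambda>\<kappa>. \<forall>v\<in>S. \<not> \<kappa> v)" by simp
    then show ?thesis by (simp add: pred_def)
  qed
  have empty: "prob {\<kappa>. \<forall>v\<in>F. \<not> \<kappa> v} \<le> ?s ^ n"
    if ex: "\<exists>S. S \<subseteq> F \<and> finite S \<and> int n \<le> 2 * int (card S)" for F :: "'d site set"
  proof -
    obtain S where S: "S \<subseteq> F" "finite S" "int n \<le> 2 * int (card S)" using ex by blast
    have "prob {\<kappa>. \<forall>v\<in>F. \<not> \<kappa> v} \<le> prob {\<kappa>. \<forall>v\<in>S. \<not> \<kappa> v}"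
      by (rule finite_measure_mono) (use S ev in auto)
    also have "\<dots> = (1 - p) ^ card S" by (rule measure_none[OF S(2) p])
    also have "\<dots> = ?s ^ (2 * card S)" using p by (simp add: power_mult)
    also have "\<dots> \<le> ?s ^ n" using S(3) p by (intro power_decreasing) auto
    finally show ?thesis .
  qed
  let ?U = "\<lambda>i. {\<kappa>. \<forall>v\<in>up_face c (int n) i. \<not> \<kappa> v}" and ?L = "\<lambda>i. {\<kappa>. \<forall>v\<in>low_face c (int n) i. \<not> \<kappa> v}"
  have fin: "finite I" using card_I card_ge_0_finite by force
  have "{\<kappa>. \<not> faces_seeded \<kappa> c n} = (\<Union>i\<in>I. ?U i \<union> ?L i)" by (auto simp: faces_seeded_def)
  also have "prob \<dots> \<le> (\<Sum>i\<in>I. prob (?U i \<union> ?L i))"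
    by (rule finite_measure_subadditive_finite) (use ev fin in auto)
  also have "\<dots> \<le> (\<Sum>i\<in>I. ?s ^ n + ?s ^ n)"
  proof (rule sum_mono)
    fix i assume i: "i \<in> I"
    have "prob (?U i \<union> ?L i) \<le> prob (?U i) + prob (?L i)" by (rule measure_Un_le) (rule ev)+
    also have "\<dots> \<le> ?s ^ n + ?s ^ n"
      by (intro add_mono empty up_face_candidates[OF c _ i] low_face_candidates[OF c _ i]) (use n in auto)
    finally show "prob (?U i \<union> ?L i) \<le> ?s ^ n + ?s ^ n" .
  qed
  also have "\<dots> = 6 * ?s ^ n" by (simp add: card_I)
  finally show ?thesis .
qed

lemma measure_faces_not_seeded_tail:
  assumes c: "c \<in> surface" and N: "5 \<le> N" and p: "0 < p" "p \<le> 1"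
  shows "measure (bernoulli_field p) {\<kappa>. \<exists>n\<ge>N. \<not> faces_seeded \<kappa> c n} \<le> 6 * sqrt (1 - p) ^ N / (1 - sqrt (1 - p))"
proof -
  interpret prob_space "bernoulli_field p :: ('d site \<Rightarrow> bool) measure" by (rule prob_space_bernoulli_field)
  let ?s = "sqrt (1 - p)"
  have s: "0 \<le> ?s" "?s < 1" using p by auto
  let ?E = "\<lambda>k. {\<kappa>. \<not> faces_seeded \<kappa> c (N + k)}"
  have le: "prob (?E k) \<le> 6 * ?s ^ N * ?s ^ k" for k
    using measure_faces_not_seeded[OF c, of "N + k" p] N p by (simp add: power_add)
  have sums: "(\<lambda>k. 6 * ?s ^ N * ?s ^ k) sums (6 * ?s ^ N * (1 / (1 - ?s)))"
    using s by (intro sums_mult geometric_sums) simp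
  have summ: "summable (\<lambda>k. prob (?E k))"
    by (rule summable_comparison_test'[OF sums_summable[OF sums]]) (use le in simp)
  have "?E k \<in> events" for k
  proof -
    have "Measurable.pred (bernoulli_field p) (\<lambda>\<kappa>. \<not> faces_seeded \<kappa> c (N + k))" by measurable
    then show ?thesis by (simp add: pred_def)
  qed
  then have "prob (\<Union>k. ?E k) \<le> (\<Sum>k. prob (?E k))"
    by (intro finite_measure_subadditive_countably summ) auto
  also have "\<dots> \<le> (\<Sum>k. 6 * ?s ^ N * ?s ^ k)" by (rule suminf_le[OF le summ sums_summable[OF sums]])
  also have "\<dots> = 6 * ?s ^ N / (1 - ?s)" using sums_unique[OF sums] by simp
  also have "(\<Union>k. ?E k) = {\<kappa>. \<exists>n\<ge>N. \<not> faces_seeded \<kappa> c n}"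
    by (auto simp: le_iff_add)
  finally show ?thesis .
qed

definition nucleus :: "('d site \<Rightarrow> bool) \<Rightarrow> 'd site \<Rightarrow> nat \<Rightarrow> bool" where
  "nucleus \<kappa> c N \<longleftrightarrow> (\<forall>v\<in>surface \<inter> cube c (int N). \<kappa> v)"

lemma pred_nucleus [measurable]: "Measurable.pred (bernoulli_field p) (\<lambda>\<kappa>. nucleus \<kappa> c N)"
  unfolding nucleus_def by simp

lemma cube_mono: "m \<le> n \<Longrightarrow> cube c m \<subseteq> cube c n"
  by (fastforce simp: cube_def)

lemma cube_translate:
  assumes "c \<in> coordinate_sites I"
  shows "cube c n \<subseteq> (+) c ` cube 0 n"
proof
  fix v assume "v \<in> cube c n"
  then have "v - c \<in> cube 0 n" using assms by (auto simp: cube_def coordinate_sites_def)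
  then show "v \<in> (+) c ` cube 0 n" by (rule image_eqI[rotated]) simp
qed

lemma finite_cube: "finite (cube c n)"
  by (simp add: cube_box finite_box)

text \<open>The exponent is taken from the cube about 0, so that one bound serves all
  centres.\<close>

lemma measure_nucleus:
  assumes c: "c \<in> surface" and p: "0 \<le> p" "p \<le> 1"
  shows "p ^ card (cube 0 (int N)) \<le> measure (bernoulli_field p) {\<kappa>. nucleus \<kappa> c N}"
proof -
  have "card (cube c (int N)) \<le> card ((+) c ` cube 0 (int N))"
    using cube_translate[of c "int N"] c by (intro card_mono) (auto simp: finite_cube surface_def)
  also have "\<dots> \<le> card (cube 0 (int N))" by (rule card_image_le) (rule finite_cube)
  finally have "card (surface \<inter> cube c (int N)) \<le> card (cube 0 (int N))"
    using card_mono[OF finite_cube, of "surface \<inter> cube c (int N)" c "int N"] by simp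
  then have "p ^ card (cube 0 (int N)) \<le> p ^ card (surface \<inter> cube c (int N))"
    using p by (intro power_decreasing)
  also have "\<dots> = measure (bernoulli_field p) {\<kappa>. nucleus \<kappa> c N}"
    unfolding nucleus_def by (rule measure_all[symmetric]) (use p finite_cube in auto)
  finally show ?thesis .
qed

text \<open>The nucleus depends on the inner cube and the faces on the shells outside it, so the
  probabilities multiply; the faces contribute at least 1 / 2. The radius \<open>N + M\<close>
  covers both ranges in either order of \<open>N\<close> and \<open>M\<close>.\<close>

lemma nucleus_grown:
  assumes c: "c \<in> surface" and p: "0 < p" "p \<le> 1" and N: "5 \<le> N"
    and N_half: "6 * sqrt (1 - p) ^ N / (1 - sqrt (1 - p)) \<le> 1 / 2"
  shows "p ^ card (cube 0 (int N)) / 2 \<le>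
      measure (bernoulli_field p) {\<kappa>. nucleus \<kappa> c N \<and> (\<forall>n\<in>{N..<M}. faces_seeded \<kappa> c n)}" (is ?le)
    and "depends_on (\<lambda>\<kappa>. nucleus \<kappa> c N \<and> (\<forall>n\<in>{N..<M}. faces_seeded \<kappa> c n)) (cube c (int (N + M)))" (is ?dep)
proof -
  interpret prob_space "bernoulli_field p :: ('d site \<Rightarrow> bool) measure" by (rule prob_space_bernoulli_field)
  have dep_nucleus: "depends_on (\<lambda>\<kappa>. nucleus \<kappa> c N) (cube c (int N))"
    by (auto simp: depends_on_def nucleus_def)
  have dep_faces: "depends_on (\<lambda>\<kappa>. \<forall>n\<in>{N..<M}. faces_seeded \<kappa> c n) (cube c (int (N + M)) - cube c (int N))"
    unfolding depends_on_def
  proof (intro allI impI ball_cong refl)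
    fix \<kappa> \<kappa>' :: "'d site \<Rightarrow> bool" and n
    assume eq: "\<forall>x\<in>cube c (int (N + M)) - cube c (int N). \<kappa> x = \<kappa>' x" and n: "n \<in> {N..<M}"
    have "cube c (int n + 1) - cube c (int n) \<subseteq> cube c (int (N + M)) - cube c (int N)"
      using cube_mono[of "int n + 1" "int (N + M)" c] cube_mono[of "int N" "int n" c] n by fastforce
    then have "\<forall>x\<in>cube c (int n + 1) - cube c (int n). \<kappa> x = \<kappa>' x" using eq by blast
    then show "faces_seeded \<kappa> c n = faces_seeded \<kappa>' c n"
      using faces_seeded_depends[of c n] unfolding depends_on_def by blast
  qed
  have pred_faces: "Measurable.pred (bernoulli_field p) (\<lambda>\<kappa>. \<forall>n\<in>{N..<M}. faces_seeded \<kappa> c n)"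
    by measurable
  let ?T = "{\<kappa>. \<exists>n\<ge>N. \<not> faces_seeded \<kappa> c n}"
  have tail_le: "prob ?T \<le> 1 / 2"
    using measure_faces_not_seeded_tail[OF c N p] N_half by simp
  have T: "?T \<in> events"
  proof -
    have "Measurable.pred (bernoulli_field p) (\<lambda>\<kappa>. \<exists>n\<ge>N. \<not> faces_seeded \<kappa> c n)" by measurable
    then show ?thesis by (simp add: pred_def)
  qed
  have F: "{\<kappa>. \<forall>n\<in>{N..<M}. faces_seeded \<kappa> c n} \<in> events"
    using pred_faces by (simp add: pred_def)
  have "1 / 2 \<le> 1 - prob ?T" using tail_le by simp
  also have "\<dots> = prob (UNIV - ?T)" using prob_compl[OF T] by simp
  also have "\<dots> \<le> prob {\<kappa>. \<forall>n\<in>{N..<M}. faces_seeded \<kappa> c n}"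
    by (rule finite_measure_mono) (use F in auto)
  finally have half: "1 / 2 \<le> prob {\<kappa>. \<forall>n\<in>{N..<M}. faces_seeded \<kappa> c n}" .
  have "p ^ card (cube 0 (int N)) * (1 / 2) \<le>
      prob {\<kappa>. nucleus \<kappa> c N} * prob {\<kappa>. \<forall>n\<in>{N..<M}. faces_seeded \<kappa> c n}"
    using measure_nucleus[OF c, of p N] p half by (intro mult_mono) auto
  also have "\<dots> = prob {\<kappa>. nucleus \<kappa> c N \<and> (\<forall>n\<in>{N..<M}. faces_seeded \<kappa> c n)}"
    by (rule measure_conj_independent[OF dep_nucleus pred_nucleus dep_faces pred_faces, symmetric]) blast
  finally show ?le by simp
  show ?dep
    unfolding depends_on_def
  proof (intro allI impI)
    fix \<kappa> \<kappa>' :: "'d site \<Rightarrow> bool"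
    assume eq: "\<forall>x\<in>cube c (int (N + M)). \<kappa> x = \<kappa>' x"
    then have "\<forall>x\<in>cube c (int N). \<kappa> x = \<kappa>' x" using cube_mono[of "int N" "int (N + M)" c] by auto
    then have 1: "nucleus \<kappa> c N = nucleus \<kappa>' c N" using dep_nucleus unfolding depends_on_def by blast
    have "\<forall>x\<in>cube c (int (N + M)) - cube c (int N). \<kappa> x = \<kappa>' x" using eq by blast
    then have "(\<forall>n\<in>{N..<M}. faces_seeded \<kappa> c n) = (\<forall>n\<in>{N..<M}. faces_seeded \<kappa>' c n)"
      using dep_faces[unfolded depends_on_def, THEN spec, THEN spec, THEN mp] by blast
    with 1 show "(nucleus \<kappa> c N \<and> (\<forall>n\<in>{N..<M}. faces_seeded \<kappa> c n)) =
       (nucleus \<kappa>' c N \<and> (\<forall>n\<in>{N..<M}. faces_seeded \<kappa>' c n))" by (simp only:)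
  qed
qed

text \<open>The growth is truncated at a scale \<open>M\<close>, which makes the events at distant centres independent;
  \<open>M\<close> is chosen after the number of centres, so that failure beyond scale \<open>M\<close> is unlikely at
  all of them simultaneously.\<close>

lemma surface_filled_whp:
  assumes c: "c \<in> surface" and p: "0 < p" "p \<le> 1" and e: "0 < e"
  obtains G where "Measurable.pred (bernoulli_field p) G" "1 - e \<le> measure (bernoulli_field p) {\<kappa>. G \<kappa>}"
    "\<And>\<kappa> A. G \<kappa> \<Longrightarrow> spreads A \<Longrightarrow> (\<And>v. v \<in> surface \<Longrightarrow> \<kappa> v \<Longrightarrow> v \<in> A) \<Longrightarrow> surface \<subseteq> A"
proof -
  interpret prob_space "bernoulli_field p :: ('d site \<Rightarrow> bool) measure" by (rule prob_space_bernoulli_field)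
  let ?s = "sqrt (1 - p)"
  have s: "0 \<le> ?s" "?s < 1" using p by auto
  have "(\<lambda>N. 6 * ?s ^ N / (1 - ?s)) \<longlonglongrightarrow> 6 * 0 / (1 - ?s)"
    by (intro tendsto_intros LIMSEQ_power_zero) (use s in auto)
  then have tail0: "(\<lambda>N. 6 * ?s ^ N / (1 - ?s)) \<longlonglongrightarrow> 0" by simp
  have small: "\<exists>N\<ge>5. 6 * ?s ^ N / (1 - ?s) \<le> d" if "0 < d" for d
  proof -
    have "eventually (\<lambda>N. 6 * ?s ^ N / (1 - ?s) < d \<and> 5 \<le> N) sequentially"
      using order_tendstoD(2)[OF tail0 that] eventually_ge_at_top by (rule eventually_conj)
    then obtain N where "6 * ?s ^ N / (1 - ?s) < d \<and> 5 \<le> N" by (auto simp: eventually_sequentially)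
    then show ?thesis by (intro exI[of _ N]) simp
  qed
  obtain N where N: "5 \<le> N" "6 * ?s ^ N / (1 - ?s) \<le> 1 / 2" using small[of "1 / 2"] by auto
  define a where "a = p ^ card (cube 0 (int N)) / 2"
  have "p ^ card (cube 0 (int N)) \<le> 1" using p by (intro power_le_one) auto
  then have a: "0 < a" "a \<le> 1" using p by (simp_all add: a_def)
  have "(\<lambda>m. (1 - a) ^ m) \<longlonglongrightarrow> 0" using a by (intro LIMSEQ_power_zero) auto
  then have "eventually (\<lambda>m. (1 - a) ^ m < e / 2) sequentially" using order_tendstoD(2) e half_gt_zero by blast
  then obtain m where m: "(1 - a) ^ m < e / 2" by (auto simp: eventually_sequentially)
  \<comment> \<open>A share of e / 2 for each of the \<open>m\<close> centres; m + 1 keeps the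
    denominator positive.\<close>
  obtain M where M: "5 \<le> M" "6 * ?s ^ M / (1 - ?s) \<le> e / (2 * (real m + 1))"
    using small[of "e / (2 * (real m + 1))"] e by auto
  obtain i j k where I: "I = {i, j, k}" "i \<noteq> j" "i \<noteq> k" "j \<noteq> k" using card_I card_3_iff[of I] by metis
  then have ij: "i \<in> I" "j \<in> I" by auto
  obtain w where w: "\<And>n. w n \<in> surface" "\<And>n. w n $ i - w n $ j = c $ i - c $ j + int n"
    using surface_path[OF c ij I(2)] by metis
  \<comment> \<open>Inside a cube of radius N + M the difference of coordinates \<open>i\<close> and
    \<open>j\<close> varies by at most 2 * (N + M) from its value at the centre. Along the path this
    difference grows by one per move, so spacing above 4 * (N + M) separates the cubes.\<close>
  define L where "L = 4 * (N + M) + 1"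
  define ctr where "ctr = (\<lambda>k. w (k * L))"
  have ctr: "ctr k \<in> surface" for k using w by (simp add: ctr_def)
  have disj: "cube (ctr k) (int (N + M)) \<inter> cube (ctr l) (int (N + M)) = {}" if "k \<noteq> l" for k l
  proof (rule ccontr)
    assume "\<not> ?thesis"
    then obtain v where v: "v \<in> cube (ctr k) (int (N + M))" "v \<in> cube (ctr l) (int (N + M))" by blast
    have b: "\<bar>v $ i - ctr t $ i\<bar> \<le> int (N + M)" "\<bar>v $ j - ctr t $ j\<bar> \<le> int (N + M)" if "t = k \<or> t = l" for t
      using v that ij by (auto simp: cube_def)
    have "\<bar>(ctr k $ i - ctr k $ j) - (ctr l $ i - ctr l $ j)\<bar> \<le> 4 * int (N + M)"
      using b[of k, simplified] b[of l, simplified] by simp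
    then have "\<bar>int (k * L) - int (l * L)\<bar> \<le> 4 * int (N + M)" by (simp add: ctr_def w(2))
    moreover have "int L \<le> \<bar>int (k * L) - int (l * L)\<bar>"
    proof -
      have "int L * 1 \<le> int L * \<bar>int k - int l\<bar>" using that by (intro mult_left_mono) auto
      also have "\<dots> = \<bar>int L * (int k - int l)\<bar>" by (simp add: abs_mult)
      also have "\<dots> = \<bar>int (k * L) - int (l * L)\<bar>" by (simp add: algebra_simps)
      finally show ?thesis by simp
    qed
    ultimately show False by (simp add: L_def)
  qed
  define X where "X = (\<lambda>k \<kappa>. nucleus \<kappa> (ctr k) N \<and> (\<forall>n\<in>{N..<M}. faces_seeded \<kappa> (ctr k) n))"
  define Y where "Y = (\<lambda>k \<kappa>. \<exists>n\<ge>M. \<not> faces_seeded \<kappa> (ctr k) n)"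
  have X_pred[measurable]: "Measurable.pred (bernoulli_field p) (X k)" for k unfolding X_def by measurable
  have Y_pred[measurable]: "Measurable.pred (bernoulli_field p) (Y k)" for k unfolding Y_def by measurable
  \<comment> \<open>At a centre with \<open>X\<close> and without \<open>Y\<close>, \<open>X\<close>
    gives the faces below scale \<open>M\<close> and the failure of \<open>Y\<close> those from
    \<open>M\<close> on.\<close>
  define G where "G = (\<lambda>\<kappa>. (\<exists>k\<in>{..<m}. X k \<kappa>) \<and> (\<forall>k\<in>{..<m}. \<not> Y k \<kappa>))"
  have G_pred[measurable]: "Measurable.pred (bernoulli_field p) G" unfolding G_def by measurable
  have noX: "prob {\<kappa>. \<forall>k\<in>{..<m}. \<not> X k \<kappa>} \<le> (1 - a) ^ card {..<m}"
  proof (rule measure_none_independent)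
    show "depends_on (X k) (cube (ctr k) (int (N + M)))" for k
      unfolding X_def by (rule nucleus_grown(2)[OF ctr p N])
    show "a \<le> prob {\<kappa>. X k \<kappa>}" for k
      unfolding X_def a_def by (rule nucleus_grown(1)[OF ctr p N])
  qed (use disj a in auto)
  have anyY: "prob {\<kappa>. \<exists>k\<in>{..<m}. Y k \<kappa>} \<le> e / 2"
  proof -
    have "{\<kappa>. \<exists>k\<in>{..<m}. Y k \<kappa>} = (\<Union>k\<in>{..<m}. {\<kappa>. Y k \<kappa>})" by auto
    also have "prob \<dots> \<le> (\<Sum>k<m. prob {\<kappa>. Y k \<kappa>})"
      by (rule finite_measure_subadditive_finite) (use Y_pred in \<open>auto simp: pred_def\<close>)
    also have "\<dots> \<le> (\<Sum>k<m. e / (2 * (real m + 1)))"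
    proof (rule sum_mono)
      fix k
      have "prob {\<kappa>. Y k \<kappa>} \<le> 6 * ?s ^ M / (1 - ?s)"
        unfolding Y_def by (rule measure_faces_not_seeded_tail[OF ctr M(1) p])
      with M(2) show "prob {\<kappa>. Y k \<kappa>} \<le> e / (2 * (real m + 1))" by linarith
    qed
    also have "\<dots> = e / 2 * (real m / (real m + 1))" by simp
    also have "\<dots> \<le> e / 2 * 1" using e by (intro mult_left_mono) auto
    finally show ?thesis by simp
  qed
  have ev: "{\<kappa>. R \<kappa>} \<in> events" if "Measurable.pred (bernoulli_field p) R" for R
    using that by (simp add: pred_def)
  have "1 - prob {\<kappa>. G \<kappa>} = prob (UNIV - {\<kappa>. G \<kappa>})" using prob_compl[OF ev[OF G_pred]] by simp
  also have "UNIV - {\<kappa>. G \<kappa>} = {\<kappa>. \<forall>k\<in>{..<m}. \<not> X k \<kappa>} \<union> {\<kappa>. \<exists>k\<in>{..<m}. Y k \<kappa>}"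
    by (auto simp: G_def)
  also have "prob \<dots> \<le> prob {\<kappa>. \<forall>k\<in>{..<m}. \<not> X k \<kappa>} + prob {\<kappa>. \<exists>k\<in>{..<m}. Y k \<kappa>}"
    by (rule measure_Un_le) (rule ev, measurable)+
  also have "\<dots> \<le> e" using noX anyY m by simp
  finally have "1 - e \<le> prob {\<kappa>. G \<kappa>}" by simp
  moreover have "surface \<subseteq> A"
    if G: "G \<kappa>" and A: "spreads A" "\<And>v. v \<in> surface \<Longrightarrow> \<kappa> v \<Longrightarrow> v \<in> A" for \<kappa> A
  proof -
    obtain k where k: "X k \<kappa>" "\<not> Y k \<kappa>" using G unfolding G_def by blast
    show ?thesis
    proof (rule surface_filled[OF ctr[of k], of N])
      show "\<forall>v\<in>surface \<inter> cube (ctr k) (int N). \<kappa> v" using k(1) unfolding X_def nucleus_def by blast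
      show "faces_seeded \<kappa> (ctr k) n" if "N \<le> n" for n
        using k that unfolding X_def Y_def by (cases "n < M") auto
    qed (use N A in auto)
  qed
  ultimately show ?thesis using that G_pred by blast
qed

end

section \<open>The limit of small densities\<close>

definition site_of :: "bool \<Rightarrow> bool \<Rightarrow> site_state" where
  "site_of c s = (if c then Closed else if s then Initially_Occupied else Initially_Vacant)"

text \<open>The second coin has the conditional density of occupied sites among open ones. It is
  tossed at closed sites too and ignored there, which makes the seed field independent of the closed
  field on all of the lattice.\<close>

lemma site_pmf_bind:
  assumes "0 \<le> p" "0 \<le> q" "q < 1" "p + q \<le> 1"
  shows "site_pmf p q = bind_pmf (bernoulli_pmf q) (\<lambda>c. map_pmf (site_of c) (bernoulli_pmf (p / (1 - q))))"
proof (rule pmf_eqI)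
  fix s
  have p': "0 \<le> p / (1 - q)" "p / (1 - q) \<le> 1" using assms by (auto simp: field_simps)
  have pre: "site_of True -` {s} = (if s = Closed then UNIV else {})"
    "site_of False -` {s} = (case s of Closed \<Rightarrow> {} | Initially_Occupied \<Rightarrow> {True} | Initially_Vacant \<Rightarrow> {False})"
    for s by (auto simp: site_of_def split: site_state.split if_splits)
  have "pmf (site_pmf p q) s = (case s of Closed \<Rightarrow> q | Initially_Occupied \<Rightarrow> p | Initially_Vacant \<Rightarrow> 1 - p - q)"
    by (rule pmf_site_pmf) (use assms in auto)
  also have "\<dots> = pmf (map_pmf (site_of True) (bernoulli_pmf (p / (1 - q)))) s * q +
      pmf (map_pmf (site_of False) (bernoulli_pmf (p / (1 - q)))) s * (1 - q)"
    using assms p' by (cases s) (simp_all add: pmf_map pre measure_pmf_single field_simps)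
  also have "\<dots> = pmf (bind_pmf (bernoulli_pmf q) (\<lambda>c. map_pmf (site_of c) (bernoulli_pmf (p / (1 - q))))) s"
    using assms by (simp add: pmf_bind)
  finally show "pmf (site_pmf p q) s =
     pmf (bind_pmf (bernoulli_pmf q) (\<lambda>c. map_pmf (site_of c) (bernoulli_pmf (p / (1 - q))))) s" .
qed

lemma measurable_site_of:
  "(\<lambda>(\<kappa>, \<sigma>) x. site_of (\<kappa> x) (\<sigma> x)) \<in> measurable (bernoulli_field q \<Otimes>\<^sub>M bernoulli_field p') (config_measure p q)"
proof -
  have "(\<lambda>w. site_of (fst w x) (snd w x)) \<in> measurable (bernoulli_field q \<Otimes>\<^sub>M bernoulli_field p') (measure_pmf (site_pmf p q))" for x
  proof -
    have [measurable]: "Measurable.pred (bernoulli_field q \<Otimes>\<^sub>M bernoulli_field p') (\<lambda>w. fst w x)"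
      "Measurable.pred (bernoulli_field q \<Otimes>\<^sub>M bernoulli_field p') (\<lambda>w. snd w x)"
      by (rule measurable_compose[OF measurable_fst pred_bernoulli_field],
          rule measurable_compose[OF measurable_snd pred_bernoulli_field])
    have "(\<lambda>w. site_of (fst w x) (snd w x)) \<in> measurable (bernoulli_field q \<Otimes>\<^sub>M bernoulli_field p') (count_space UNIV)"
      unfolding site_of_def by measurable
    then show ?thesis by (simp cong: measurable_cong_sets)
  qed
  then show ?thesis unfolding config_measure_def case_prod_beta
    by (intro measurable_PiM_single') (auto simp: PiE_def)
qed

text \<open>Both measures are compared on finite-dimensional cylinders: the seeds are integrated out
  for fixed closed sites, and the remaining product splits by independence of the closed
  field.\<close>

lemma config_measure_eq_distr:
  assumes "0 \<le> p" "0 \<le> q" "q < 1" "p + q \<le> 1"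
  shows "config_measure p q = distr (bernoulli_field q \<Otimes>\<^sub>M bernoulli_field (p / (1 - q))) (config_measure p q)
     (\<lambda>(\<kappa>, \<sigma>) x. site_of (\<kappa> x) (\<sigma> x))" (is "_ = distr (?C \<Otimes>\<^sub>M ?S) _ ?f")
proof -
  interpret C: prob_space ?C by (rule prob_space_bernoulli_field)
  interpret S: prob_space ?S by (rule prob_space_bernoulli_field)
  interpret product_prob_space "\<lambda>_. measure_pmf (site_pmf p q)" UNIV
    by (rule product_prob_space_pmf)
  show ?thesis
    unfolding config_measure_def
  proof (rule measure_eqI_PiM_infinite)
    fix J :: "'a site set" and A :: "'a site \<Rightarrow> site_state set" assume J: "finite J" "J \<subseteq> UNIV"
    let ?emb = "prod_emb UNIV (\<lambda>_. measure_pmf (site_pmf p q)) J (Pi\<^sub>E J A)"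
    have emb: "?emb = {\<omega>. \<forall>x\<in>J. \<omega> x \<in> A x}"
      by (auto simp: prod_emb_def space_PiM PiE_def Pi_def)
    have emb_sets: "?emb \<in> sets (PiM UNIV (\<lambda>_. measure_pmf (site_pmf p q)))"
      by (rule sets_PiM_I) (use J in auto)
    have f: "?f \<in> measurable (?C \<Otimes>\<^sub>M ?S) (PiM UNIV (\<lambda>_. measure_pmf (site_pmf p q)))"
      using measurable_site_of[of q "p / (1 - q)" p] unfolding config_measure_def .
    \<comment> \<open>The conditional probability that the state at \<open>x\<close> lies in
      \<open>A x\<close>, given whether \<open>x\<close> is closed.\<close>
    define e where "e = (\<lambda>x c. emeasure (bernoulli_pmf (p / (1 - q))) {s. site_of c s \<in> A x})"
    have "emeasure (distr (?C \<Otimes>\<^sub>M ?S) (PiM UNIV (\<lambda>_. measure_pmf (site_pmf p q))) ?f) ?emb =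
        emeasure (?C \<Otimes>\<^sub>M ?S) (?f -` ?emb \<inter> space (?C \<Otimes>\<^sub>M ?S))"
      by (rule emeasure_distr[OF f emb_sets])
    also have "\<dots> = (\<integral>\<^sup>+ \<kappa>. emeasure ?S (Pair \<kappa> -` (?f -` ?emb \<inter> space (?C \<Otimes>\<^sub>M ?S))) \<partial>?C)"
      by (rule S.emeasure_pair_measure_alt) (rule measurable_sets[OF f emb_sets])
    also have "\<dots> = (\<integral>\<^sup>+ \<kappa>. (\<Prod>x\<in>J. e x (\<kappa> x)) \<partial>?C)"
    proof (rule nn_integral_cong)
      fix \<kappa> :: "'a site \<Rightarrow> bool"
      have "Pair \<kappa> -` (?f -` ?emb \<inter> space (?C \<Otimes>\<^sub>M ?S)) = {\<sigma>. \<forall>x\<in>J. \<sigma> x \<in> {s. site_of (\<kappa> x) s \<in> A x}}"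
        unfolding emb by (auto simp: space_pair_measure)
      then show "emeasure ?S (Pair \<kappa> -` (?f -` ?emb \<inter> space (?C \<Otimes>\<^sub>M ?S))) = (\<Prod>x\<in>J. e x (\<kappa> x))"
        using emeasure_bernoulli_field_PiE[OF J(1), of "p / (1 - q)" "\<lambda>x. {s. site_of (\<kappa> x) s \<in> A x}"]
        unfolding e_def by simp
    qed
    also have "\<dots> = (\<Prod>x\<in>J. \<integral>\<^sup>+ \<kappa>. e x (\<kappa> x) \<partial>?C)"
    proof (rule C.indep_vars_nn_integral[OF J(1)])
      have "C.indep_vars (\<lambda>_. borel) (\<lambda>x \<kappa>. e x (\<kappa> x)) UNIV"
        by (rule C.indep_vars_compose2[OF indep_vars_bernoulli_field]) simp
      then show "C.indep_vars (\<lambda>_. borel) (\<lambda>x \<kappa>. e x (\<kappa> x)) J" by (rule C.indep_vars_subset) simp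
    qed simp
    also have "\<dots> = (\<Prod>x\<in>J. emeasure (site_pmf p q) (A x))"
    proof (rule prod.cong[OF refl])
      fix x
      have "(\<integral>\<^sup>+ \<kappa>. e x (\<kappa> x) \<partial>?C) = (\<integral>\<^sup>+ c. e x c \<partial>distr ?C (bernoulli_pmf q) (\<lambda>\<kappa>. \<kappa> x))"
      proof (rule nn_integral_distr[symmetric])
        show "(\<lambda>\<kappa>. \<kappa> x) \<in> measurable ?C (measure_pmf (bernoulli_pmf q))"
          unfolding bernoulli_field_def by (rule measurable_component_singleton) simp
      qed simp
      also have "\<dots> = (\<integral>\<^sup>+ c. e x c \<partial>bernoulli_pmf q)" unfolding distr_bernoulli_field_component ..
      also have "\<dots> = emeasure (site_pmf p q) (A x)"
        unfolding site_pmf_bind[OF assms] emeasure_bind_pmf by (simp add: e_def vimage_def)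
      finally show "(\<integral>\<^sup>+ \<kappa>. e x (\<kappa> x) \<partial>?C) = emeasure (site_pmf p q) (A x)" .
    qed
    also have "\<dots> = emeasure (PiM UNIV (\<lambda>_. measure_pmf (site_pmf p q))) ?emb"
      by (rule emeasure_PiM_emb[symmetric]) (use J in auto)
    finally show "emeasure (PiM UNIV (\<lambda>_. measure_pmf (site_pmf p q))) ?emb =
      emeasure (distr (?C \<Otimes>\<^sub>M ?S) (PiM UNIV (\<lambda>_. measure_pmf (site_pmf p q))) ?f) ?emb" by simp
  next
    show "finite_measure (PiM UNIV (\<lambda>_::'a site. measure_pmf (site_pmf p q)))"
      by (rule P.finite_measure_axioms)
  qed simp_all
qed

lemma sheet_spans_infinite_set:
  fixes \<sigma> \<kappa> :: "('d::finite) site \<Rightarrow> bool"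
  assumes sh: "sheet I h" and h0: "h 0 = 0" and open_sites: "\<And>v. v \<in> sheet.surface I h \<Longrightarrow> \<not> \<kappa> v"
    and G: "\<And>A. sheet.spreads I h A \<Longrightarrow> (\<And>v. v \<in> sheet.surface I h \<Longrightarrow> \<sigma> v \<Longrightarrow> v \<in> A) \<Longrightarrow> sheet.surface I h \<subseteq> A"
  shows "in_infinite_occupied_set (modified_rule 2) (\<lambda>x. site_of (\<kappa> x) (\<sigma> x)) 0"
proof -
  interpret sheet I h by (rule sh)
  let ?\<omega> = "\<lambda>x. site_of (\<kappa> x) (\<sigma> x)"
  let ?A = "eventually_occupied (modified_rule 2) ?\<omega>"
  have sub: "surface \<subseteq> ?A"
  proof (rule G)
    show "spreads ?A" unfolding spreads_def
      using open_sites by (auto intro!: eventually_occupied_closed simp: site_of_def split: if_splits)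
    show "v \<in> ?A" if "v \<in> surface" "\<sigma> v" for v
      using that open_sites[of v] by (intro initially_in_eventually) (simp add: site_of_def)
  qed
  have zero: "0 \<in> surface" using h0 by (simp add: surface_def coordinate_sites_def)
  obtain i j k where I: "I = {i, j, k}" "i \<noteq> j" "i \<noteq> k" "j \<noteq> k" using card_I card_3_iff[of I] by metis
  then have ij: "i \<in> I" "j \<in> I" by auto
  obtain w where w: "w 0 = 0" "\<And>n. w n \<in> surface" "\<And>n. neighbors (w n) (w (Suc n))"
      "\<And>n. w n $ i - w n $ j = 0 $ i - 0 $ j + int n"
    using surface_path[OF zero ij I(2)] by metis
  have "inj w" by (rule injI) (use w(4) in \<open>metis add_left_cancel of_nat_eq_iff\<close>)
  then have "infinite (range w)" by (rule range_inj_infinite)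
  moreover have "connected_sites (range w)" by (rule connected_sites_range) (rule w(3))
  moreover have "0 \<in> range w" using w(1) by (metis rangeI)
  moreover have "range w \<subseteq> ?A" using w(2) sub by blast
  ultimately show ?thesis unfolding in_infinite_occupied_set_def by blast
qed

text \<open>Integration over the closed field. The sheet is chosen separately for each
  \<open>\<kappa>\<close>, and no measurability of this choice arises, because it serves only to
  bound the measure of a section of the fixed measurable event \<open>?E\<close>.\<close>

lemma prob_in_infinite_ge:
  fixes p q r e :: real
  assumes d: "3 \<le> CARD('d::finite)" and pq: "0 < p" "0 < q" "q < 1" "p + q \<le> 1"
    and r: "0 \<le> r" "8 * CARD('d) * r \<le> 1" "q \<le> r ^ 41" and e: "0 < e" "e \<le> 1"
  shows "(1 - e) * (1 - 4 * r) \<le>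
    measure (config_measure p q) {\<omega>. in_infinite_occupied_set (modified_rule 2) \<omega> (0 :: 'd site)}"
proof -
  let ?C = "bernoulli_field q :: ('d site \<Rightarrow> bool) measure"
  let ?S = "bernoulli_field (p / (1 - q)) :: ('d site \<Rightarrow> bool) measure"
  let ?f = "\<lambda>(\<kappa>, \<sigma>) x :: 'd site. site_of (\<kappa> x) (\<sigma> x)"
  let ?E = "{\<omega>. in_infinite_occupied_set (modified_rule 2) \<omega> (0 :: 'd site)}"
  interpret C: prob_space ?C by (rule prob_space_bernoulli_field)
  interpret S: prob_space ?S by (rule prob_space_bernoulli_field)
  interpret W: prob_space "config_measure p q :: 'd config measure"
    unfolding config_measure_def by (intro prob_space_PiM prob_space_measure_pmf)
  have p': "0 < p / (1 - q)" "p / (1 - q) \<le> 1" using pq by (auto simp: field_simps)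
  have "Measurable.pred (config_measure p q) (\<lambda>\<omega>. in_infinite_occupied_set (modified_rule 2) \<omega> (0 :: 'd site))"
    by (rule pred_in_infinite_occupied_set, rule pred_eventually_occupied, rule pred_modified_rule)
  then have E: "?E \<in> sets (config_measure p q)" by (simp add: pred_def)
  obtain I :: "'d set" where I: "card I = 3" using d obtain_subset_with_card_n by metis
  have fibre: "ennreal (1 - e) \<le> emeasure ?S (Pair \<kappa> -` (?f -` ?E \<inter> space (?C \<Otimes>\<^sub>M ?S)))"
    if \<kappa>: "sheet_config \<kappa>" for \<kappa>
  proof -
    obtain h where h: "sheet I h" "h 0 = 0" "\<And>v. v \<in> {x. \<kappa> x} \<Longrightarrow> \<not> (0 \<le> h v \<and> h v \<le> 40)"
      using sheet_exists[of "{x. \<kappa> x}" I] \<kappa> I unfolding sheet_config_def by metis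
    interpret sheet I h by (rule h(1))
    have zero: "0 \<in> surface" using h(2) by (simp add: surface_def coordinate_sites_def)
    obtain G where G: "Measurable.pred ?S G" "1 - e \<le> measure ?S {\<sigma>. G \<sigma>}"
      "\<And>\<sigma> A. G \<sigma> \<Longrightarrow> spreads A \<Longrightarrow> (\<And>v. v \<in> surface \<Longrightarrow> \<sigma> v \<Longrightarrow> v \<in> A) \<Longrightarrow> surface \<subseteq> A"
      using surface_filled_whp[OF zero p' e(1)] by metis
    have "in_infinite_occupied_set (modified_rule 2) (\<lambda>x. site_of (\<kappa> x) (\<sigma> x)) 0" if "G \<sigma>" for \<sigma>
    proof (rule sheet_spans_infinite_set[OF h(1,2)])
      show "\<not> \<kappa> v" if "v \<in> surface" for v using that h(3)[of v] by (auto simp: surface_def)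
    qed (use G(3)[OF that] in blast)
    then have sub: "{\<sigma>. G \<sigma>} \<subseteq> Pair \<kappa> -` (?f -` ?E \<inter> space (?C \<Otimes>\<^sub>M ?S))"
      by (auto simp: space_pair_measure)
    have "Pair \<kappa> -` (?f -` ?E \<inter> space (?C \<Otimes>\<^sub>M ?S)) \<in> sets ?S"
      by (rule sets_Pair1) (rule measurable_sets[OF measurable_site_of E])
    then have "emeasure ?S {\<sigma>. G \<sigma>} \<le> emeasure ?S (Pair \<kappa> -` (?f -` ?E \<inter> space (?C \<Otimes>\<^sub>M ?S)))"
      by (rule emeasure_mono[OF sub])
    moreover have "ennreal (1 - e) \<le> emeasure ?S {\<sigma>. G \<sigma>}"
      unfolding S.emeasure_eq_measure using G(2) by (rule ennreal_leI)
    ultimately show ?thesis by (rule order_trans[rotated])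
  qed
  have sc: "{\<kappa>. sheet_config \<kappa>} \<in> sets ?C" using pred_sheet_config by (simp add: pred_def)
  have "ennreal ((1 - e) * (1 - 4 * r)) \<le> ennreal ((1 - e) * measure ?C {\<kappa>. sheet_config \<kappa>})"
    using measure_sheet_config[OF r(1,2) _ r(3)] pq e by (intro ennreal_leI mult_left_mono) auto
  also have "\<dots> = ennreal (1 - e) * emeasure ?C {\<kappa>. sheet_config \<kappa>}"
    unfolding C.emeasure_eq_measure using e by (intro ennreal_mult) auto
  also have "\<dots> = (\<integral>\<^sup>+ \<kappa>. ennreal (1 - e) * indicator {\<kappa>. sheet_config \<kappa>} \<kappa> \<partial>?C)"
    by (rule nn_integral_cmult_indicator[OF sc, symmetric])
  also have "\<dots> \<le> (\<integral>\<^sup>+ \<kappa>. emeasure ?S (Pair \<kappa> -` (?f -` ?E \<inter> space (?C \<Otimes>\<^sub>M ?S))) \<partial>?C)"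
    by (rule nn_integral_mono) (use fibre in \<open>auto simp: indicator_def\<close>)
  also have "\<dots> = emeasure (?C \<Otimes>\<^sub>M ?S) (?f -` ?E \<inter> space (?C \<Otimes>\<^sub>M ?S))"
    by (rule S.emeasure_pair_measure_alt[symmetric]) (rule measurable_sets[OF measurable_site_of E])
  also have "\<dots> = emeasure (distr (?C \<Otimes>\<^sub>M ?S) (config_measure p q) ?f) ?E"
    by (rule emeasure_distr[OF measurable_site_of E, symmetric])
  also have "\<dots> = emeasure (config_measure p q) ?E"
    by (subst config_measure_eq_distr[symmetric]) (use pq in auto)
  also have "\<dots> = ennreal (W.prob ?E)" by (rule W.emeasure_eq_measure)
  finally show ?thesis by (simp add: ennreal_le_iff)
qed

theorem theorem1:
  assumes "CARD('d::finite) \<ge> 3"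
  shows "(((\<lambda>(p, q). \<P>(\<omega> in config_measure p q.
              (0 :: 'd site) \<in> eventually_occupied (standard_rule 2) \<omega>)) \<longlongrightarrow> 1) small_params) \<and>
    (((\<lambda>(p, q). \<P>(\<omega> in config_measure p q.
              in_infinite_occupied_set (standard_rule 2) \<omega> (0 :: 'd site))) \<longlongrightarrow> 1) small_params) \<and>
    (((\<lambda>(p, q). \<P>(\<omega> in config_measure p q.
              (0 :: 'd site) \<in> eventually_occupied (modified_rule 2) \<omega>)) \<longlongrightarrow> 1) small_params) \<and>
    (((\<lambda>(p, q). \<P>(\<omega> in config_measure p q.
              in_infinite_occupied_set (modified_rule 2) \<omega> (0 :: 'd site))) \<longlongrightarrow> 1) small_params)"
proof -
  let ?M = "config_measure :: real \<Rightarrow> real \<Rightarrow> 'd config measure"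
  let ?Q = "\<lambda>\<omega>. in_infinite_occupied_set (modified_rule 2) \<omega> (0 :: 'd site)"
  \<comment> \<open>\<open>?Q\<close> implies each of the other three events, so one lower bound
    serves all four.\<close>
  have limit: "((\<lambda>(p, q). \<P>(\<omega> in ?M p q. P \<omega>)) \<longlongrightarrow> 1) small_params"
    if pred: "\<And>p q. Measurable.pred (?M p q) P" and imp: "\<And>\<omega>. ?Q \<omega> \<Longrightarrow> P \<omega>" for P
  proof (rule tendstoI)
    fix \<epsilon> :: real assume \<epsilon>: "0 < \<epsilon>"
    \<comment> \<open>Filling the sheet loses \<open>e\<close> and its existence 4 * r \<le> e; the
      last third of \<open>\<epsilon>\<close> makes the inequality strict.\<close>
    define e where "e = min (\<epsilon> / 3) 1"
    define r where "r = min (e / 4) (1 / (8 * CARD('d)))"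
    have e: "0 < e" "e \<le> 1" "3 * e \<le> \<epsilon>" using \<epsilon> by (auto simp: e_def)
    have d: "0 < real CARD('d)" by simp
    have r: "0 < r" "8 * CARD('d) * r \<le> 1" "4 * r \<le> e"
      using e d by (auto simp: r_def min_def field_simps)
    have close: "dist (case (p, q) of (p, q) \<Rightarrow> \<P>(\<omega> in ?M p q. P \<omega>)) 1 < \<epsilon>"
      if pq: "0 < p" "0 < q" "p + q \<le> 1" "q \<le> r ^ 41" for p q
    proof -
      interpret prob_space "?M p q"
        unfolding config_measure_def by (intro prob_space_PiM prob_space_measure_pmf)
      have ev: "{\<omega>. P \<omega>} \<in> events" using pred[of p q] by (simp add: pred_def)
      have "(1 - e) * (1 - 4 * r) \<le> prob {\<omega>. ?Q \<omega>}"
        by (rule prob_in_infinite_ge) (use assms pq r e in auto)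
      also have "\<dots> \<le> prob {\<omega>. P \<omega>}" by (rule finite_measure_mono) (use ev imp in auto)
      finally have "(1 - e) * (1 - 4 * r) \<le> prob {\<omega>. P \<omega>}" .
      moreover have "1 - e - 4 * r \<le> (1 - e) * (1 - 4 * r)"
        using e r by (simp add: algebra_simps)
      ultimately have "1 - \<epsilon> < prob {\<omega>. P \<omega>}" using e r by linarith
      then show ?thesis using prob_le_1[of "{\<omega>. P \<omega>}"] \<epsilon> by (simp add: dist_real_def)
    qed
    have "\<forall>x\<in>{(p, q). 0 < p \<and> 0 < q \<and> p + q \<le> 1}. x \<noteq> (0, 0) \<and> dist x (0, 0) < r ^ 41 \<longrightarrow>
        dist (case x of (p, q) \<Rightarrow> \<P>(\<omega> in ?M p q. P \<omega>)) 1 < \<epsilon>"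
    proof (intro ballI impI)
      fix x :: "real \<times> real"
      assume x: "x \<in> {(p, q). 0 < p \<and> 0 < q \<and> p + q \<le> 1}" "x \<noteq> (0, 0) \<and> dist x (0, 0) < r ^ 41"
      obtain p q where pq: "x = (p, q)" by (cases x)
      have "dist q 0 \<le> dist x (0, 0)" using dist_snd_le[of x "(0, 0)"] pq by simp
      moreover have "q \<le> dist q 0" by (simp add: dist_real_def)
      ultimately have "q \<le> r ^ 41" using x(2) by linarith
      then show "dist (case x of (p, q) \<Rightarrow> \<P>(\<omega> in ?M p q. P \<omega>)) 1 < \<epsilon>"
        using close[of p q] x(1) pq by simp
    qed
    then show "\<forall>\<^sub>F x in small_params. dist (case x of (p, q) \<Rightarrow> \<P>(\<omega> in ?M p q. P \<omega>)) 1 < \<epsilon>"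
      unfolding small_params_def eventually_at using r(1) by (intro exI[of _ "r ^ 41"]) auto
  qed
  note occ = pred_eventually_occupied[OF pred_standard_rule] pred_eventually_occupied[OF pred_modified_rule]
  note inf = pred_in_infinite_occupied_set[OF occ(1)] pred_in_infinite_occupied_set[OF occ(2)]
  have Q: "in_infinite_occupied_set (standard_rule 2) \<omega> 0" "0 \<in> eventually_occupied (standard_rule 2) \<omega>"
     "0 \<in> eventually_occupied (modified_rule 2) \<omega>" if "?Q \<omega>" for \<omega>
    using that eventually_occupied_modified_subset[of \<omega>] unfolding in_infinite_occupied_set_def by blast+
  show ?thesis
    by (intro conjI limit occ inf Q)
qed

end
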